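(* Let $a,b>0$ with $a^{\frac{N-4s}{2s}}b>\mathsf{PS}_{N,s}$, and assume, in addition to the standing assumptions (H1)-(H4) on $g$ listed in the context, that (H5) for any $u\in X_0^s(\Omega)$ the function $\zeta\mapsto\int_\Omega g(x,\zeta u(x))\,dx$ is $C^1$ on $(0,\infty)$. Then there is $\overline{\lambda}^s=\overline{\lambda}^s(a,b)\in(0,\overline{\lambda}_0^s)$ such that for every $\lambda\in(0,\overline{\lambda}^s)$ the problem $$\left(a+b\int_{\mathcal{Q}}\frac{|u(x)-u(y)|^2}{|x-y|^{N+2s}}\,dx\,dy\right)(-\Delta)^su=|u|^{2^*_s-2}u+\lambda g(x,u)\ \text{in }\Omega,\qquad u=0\ \text{in }\mathbb{R}^N\setminus\Omega,$$ does not admit nontrivial (weak) solutions, i.e. $u=0$ is the only critical point of $\mathcal{I}_{a,b}^\lambda$ in $X_0^s(\Omega)$.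
   Context: Throughout, $s\in(0,1)$, $N$ is a positive integer with $N>4s$, $\Omega\subset\mathbb{R}^N$ is a bounded domain with Lipschitz boundary, and $2^*_s:=\frac{2N}{N-2s}$. Put $\mathcal{Q}:=\mathbb{R}^{2N}\setminus(\Omega^c\times\Omega^c)$, where $\Omega^c=\mathbb{R}^N\setminus\Omega$. $X_0^s(\Omega)$ is the space of (measurable) functions $u\colon\mathbb{R}^N\to\mathbb{R}$ with $u|_\Omega\in L^2(\Omega)$, $\int_{\mathcal{Q}}\frac{|u(x)-u(y)|^2}{|x-y|^{N+2s}}\,dx\,dy<\infty$ and $u=0$ a.e. in $\mathbb{R}^N\setminus\Omega$; it is a Hilbert space with scalar product $\langle u,v\rangle=\int_{\mathcal{Q}}\frac{(u(x)-u(y))(v(x)-v(y))}{|x-y|^{N+2s}}\,dx\,dy$ and norm $\|u\|=\langle u,u\rangle^{1/2}$. $\|\cdot\|_q$ is the norm of $L^q(\Omega)$. $S_{N,s}:=\inf_{u\in X_0^s(\Omega)\setminus\{0\}}\frac{\|u\|^2}{\|u\|_{2^*_s}^2}$ and $\mathsf{PS}_{N,s}:=\frac{2s(N-4s)^{\frac{N-4s}{2s}}}{(N-2s)^{\frac{N-2s}{2s}}S_{N,s}^{\frac{N}{2s}}}$, $L_{N,s}:=\frac{4s(N-4s)^{\frac{N-4s}{2s}}}{N^{\frac{N-2s}{2s}}S_{N,s}^{\frac{N}{2s}}}$ (one has $\mathsf{PS}_{N,s}>L_{N,s}$). Standing assumptions on $g$: (H1) $g\colon\Omega\times\mathbb{R}\to\mathbb{R}$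 is a Carathéodory function with $g(x,0)=0$ for a.e. $x\in\Omega$; (H2) for a.e. $x\in\Omega$, $g(x,t)>0$ for every $t>0$ and $g(x,t)<0$ for every $t<0$; moreover there are $\mu>0$ and a nonempty open interval $I\subset(0,\infty)$ with $g(x,t)\ge\mu$ for a.e. $x\in\Omega$ and every $t\in I$; (H3) there are $c>0$ and $p\in(2,2^*_s)$ with $|g(x,t)|\le c(1+|t|^{p-1})$ for a.e. $x\in\Omega$ and all $t\in\mathbb{R}$; (H4) $\lim_{t\to0}g(x,t)/|t|=0$ uniformly with respect to $x\in\Omega$. Put $G(x,t)=\int_0^tg(x,\tau)\,d\tau$ and $\mathcal{I}_{a,b}^\lambda(u):=\frac a2\|u\|^2+\frac b4\|u\|^4-\frac1{2^*_s}\|u\|_{2^*_s}^{2^*_s}-\lambda\int_\Omega G(x,u)\,dx$ for $u\in X_0^s(\Omega)$. Weak solutions of the problem are the critical points of $\mathcal{I}_{a,b}^\lambda$, i.e. $u\in X_0^s(\Omega)$ with $(a+b\|u\|^2)\langle u,v\rangle=\int_\Omega|u|^{2^*_s-2}uv\,dx+\lambda\int_\Omega g(x,u)v\,dx$ for all $v\in X_0^s(\Omega)$; here $(-\Delta)^s$ is the fractional Laplacian rescaled so that its normalizing constant is $1$. For $\lambda\ge0$ and $u\in X_0^s(\Omega)\setminus\{0\}$ let $\mathcal{J}_{a,b}^{\lambda,u}(\zeta):=\mathcal{I}_{a,b}^\lambda(\zeta u)$, $\zeta>0$. When $a^{\frac{N-4s}{2s}}b\ge L_{N,s}$, for each $u\in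 X_0^s(\Omega)\setminus\{0\}$ there is a unique $\lambda=\lambda_0^s(u)\ge0$ for which some $\zeta>0$ satisfies $\mathcal{J}_{a,b}^{\lambda,u}(\zeta)=0$, $(\mathcal{J}_{a,b}^{\lambda,u})'(\zeta)=0$ and $\mathcal{J}_{a,b}^{\lambda,u}(\zeta)=\inf_{\varrho>0}\mathcal{J}_{a,b}^{\lambda,u}(\varrho)$. Define $\overline{\lambda}_0^s:=\inf_{u\in X_0^s(\Omega)\setminus\{0\}}\lambda_0^s(u)$. *)

theory Defs
  imports "HOL-Analysis.Analysis"
begin

text \<open>
  Throughout, the ambient space is \<open>real ^ 'n\<close>, so \<open>N = CARD('n)\<close>.  Functions are representatives:
  \<open>u = 0\<close> in the function space means \<open>u x = 0\<close> for almost every \<open>x\<close>.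
\<close>

text \<open>Near each boundary point the domain is the strict epigraph of a Lipschitz function, in the
  coordinates given by a unit vector \<open>e\<close> (vertical axis) and its orthogonal complement.\<close>

definition lipschitz_boundary :: "(real ^ 'n) set \<Rightarrow> bool" where
  "lipschitz_boundary \<Omega> \<longleftrightarrow>
     (\<forall>x0 \<in> frontier \<Omega>. \<exists>r > 0. \<exists>e L \<gamma>. norm e = 1 \<and> L-lipschitz_on {y. y \<bullet> e = 0} \<gamma> \<and>
        \<Omega> \<inter> ball x0 r = {x \<in> ball x0 r. \<gamma> (x - (x \<bullet> e) *\<^sub>R e) < x \<bullet> e})"

definition bounded_lipschitz_domain :: "(real ^ 'n) set \<Rightarrow> bool" where
  "bounded_lipschitz_domain \<Omega> \<longleftrightarrow>
     open \<Omega> \<and> connected \<Omega> \<and> \<Omega> \<noteq> {} \<and> bounded \<Omega> \<and> lipschitz_boundary \<Omega>"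

definition crit_exp :: "real \<Rightarrow> real \<Rightarrow> real" where
  "crit_exp N s = 2 * N / (N - 2 * s)"

definition Q_region :: "(real ^ 'n) set \<Rightarrow> ((real ^ 'n) \<times> (real ^ 'n)) set" where
  "Q_region \<Omega> = - ((- \<Omega>) \<times> (- \<Omega>))"

text \<open>The integrands below are measurable for the product \<open>\<sigma>\<close>-algebra of Lebesgue measurable sets, so
  integrating against the product measure agrees with Lebesgue measure on the product space.  The
  diagonal is a null set; there the quotient is \<open>0 / 0 = 0\<close>.\<close>

definition X0_space :: "real \<Rightarrow> (real ^ 'n) set \<Rightarrow> (real ^ 'n \<Rightarrow> real) set" where
  "X0_space s \<Omega> = {u. u \<in> borel_measurable lebesgue \<and>
      integrable (lebesgue_on \<Omega>) (\<lambda>x. (u x)\<^sup>2) \<and>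
      set_integrable (lebesgue \<Otimes>\<^sub>M lebesgue) (Q_region \<Omega>)
        (\<lambda>(x, y). \<bar>u x - u y\<bar>\<^sup>2 / norm (x - y) powr (real CARD('n) + 2 * s)) \<and>
      (AE x in lebesgue. x \<notin> \<Omega> \<longrightarrow> u x = 0)}"

definition X0_inner ::
    "real \<Rightarrow> (real ^ 'n) set \<Rightarrow> (real ^ 'n \<Rightarrow> real) \<Rightarrow> (real ^ 'n \<Rightarrow> real) \<Rightarrow> real" where
  "X0_inner s \<Omega> u v =
     set_lebesgue_integral (lebesgue \<Otimes>\<^sub>M lebesgue) (Q_region \<Omega>)
       (\<lambda>(x, y). (u x - u y) * (v x - v y) / norm (x - y) powr (real CARD('n) + 2 * s))"

definition X0_norm :: "real \<Rightarrow> (real ^ 'n) set \<Rightarrow> (real ^ 'n \<Rightarrow> real) \<Rightarrow> real" where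
  "X0_norm s \<Omega> u = sqrt (X0_inner s \<Omega> u u)"

definition X0_nonzero :: "real \<Rightarrow> (real ^ 'n) set \<Rightarrow> (real ^ 'n \<Rightarrow> real) set" where
  "X0_nonzero s \<Omega> = {u \<in> X0_space s \<Omega>. \<not> (AE x in lebesgue. u x = 0)}"

definition Lq_norm :: "(real ^ 'n) set \<Rightarrow> real \<Rightarrow> (real ^ 'n \<Rightarrow> real) \<Rightarrow> real" where
  "Lq_norm \<Omega> q u = (LINT x|lebesgue_on \<Omega>. \<bar>u x\<bar> powr q) powr (1 / q)"

definition S_const :: "real \<Rightarrow> (real ^ 'n) set \<Rightarrow> real" where
  "S_const s \<Omega> = (INF u \<in> X0_nonzero s \<Omega>.
     (X0_norm s \<Omega> u)\<^sup>2 / (Lq_norm \<Omega> (crit_exp (real CARD('n)) s) u)\<^sup>2)"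

definition PS_const :: "real \<Rightarrow> (real ^ 'n) set \<Rightarrow> real" where
  "PS_const s \<Omega> = (let N = real CARD('n) in
     2 * s * (N - 4 * s) powr ((N - 4 * s) / (2 * s)) /
     ((N - 2 * s) powr ((N - 2 * s) / (2 * s)) * S_const s \<Omega> powr (N / (2 * s))))"

definition caratheodory_on :: "(real ^ 'n) set \<Rightarrow> (real ^ 'n \<Rightarrow> real \<Rightarrow> real) \<Rightarrow> bool" where
  "caratheodory_on \<Omega> g \<longleftrightarrow>
     (\<forall>t. (\<lambda>x. g x t) \<in> borel_measurable (lebesgue_on \<Omega>)) \<and>
     (AE x in lebesgue_on \<Omega>. continuous_on UNIV (g x))"

definition primitive :: "(real ^ 'n \<Rightarrow> real \<Rightarrow> real) \<Rightarrow> real ^ 'n \<Rightarrow> real \<Rightarrow> real" where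
  "primitive g x t = (LBINT \<tau>=0..ereal t. g x \<tau>)"

definition energy ::
    "real \<Rightarrow> (real ^ 'n) set \<Rightarrow> (real ^ 'n \<Rightarrow> real \<Rightarrow> real) \<Rightarrow> real \<Rightarrow> real \<Rightarrow> real
      \<Rightarrow> (real ^ 'n \<Rightarrow> real) \<Rightarrow> real" where
  "energy s \<Omega> g a b l u = (let q = crit_exp (real CARD('n)) s in
     a / 2 * X0_norm s \<Omega> u ^ 2 + b / 4 * X0_norm s \<Omega> u ^ 4
     - 1 / q * Lq_norm \<Omega> q u powr q
     - l * (LINT x|lebesgue_on \<Omega>. primitive g x (u x)))"

definition weak_solution ::
    "real \<Rightarrow> (real ^ 'n) set \<Rightarrow> (real ^ 'n \<Rightarrow> real \<Rightarrow> real) \<Rightarrow> real \<Rightarrow> real \<Rightarrow> real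
      \<Rightarrow> (real ^ 'n \<Rightarrow> real) \<Rightarrow> bool" where
  "weak_solution s \<Omega> g a b l u \<longleftrightarrow> u \<in> X0_space s \<Omega> \<and>
     (\<forall>v \<in> X0_space s \<Omega>.
        (a + b * (X0_norm s \<Omega> u)\<^sup>2) * X0_inner s \<Omega> u v =
        (LINT x|lebesgue_on \<Omega>. \<bar>u x\<bar> powr (crit_exp (real CARD('n)) s - 2) * u x * v x)
        + l * (LINT x|lebesgue_on \<Omega>. g x (u x) * v x))"

definition fiber ::
    "real \<Rightarrow> (real ^ 'n) set \<Rightarrow> (real ^ 'n \<Rightarrow> real \<Rightarrow> real) \<Rightarrow> real \<Rightarrow> real \<Rightarrow> real
      \<Rightarrow> (real ^ 'n \<Rightarrow> real) \<Rightarrow> real \<Rightarrow> real" where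
  "fiber s \<Omega> g a b l u \<zeta> = energy s \<Omega> g a b l (\<lambda>x. \<zeta> * u x)"

text \<open>The infimum over \<open>\<rho> > 0\<close> is taken in the extended reals, so that it needs no lower bound.\<close>

definition lambda0 ::
    "real \<Rightarrow> (real ^ 'n) set \<Rightarrow> (real ^ 'n \<Rightarrow> real \<Rightarrow> real) \<Rightarrow> real \<Rightarrow> real
      \<Rightarrow> (real ^ 'n \<Rightarrow> real) \<Rightarrow> real" where
  "lambda0 s \<Omega> g a b u = (THE l. l \<ge> 0 \<and> (\<exists>\<zeta> > 0.
     fiber s \<Omega> g a b l u \<zeta> = 0 \<and>
     (fiber s \<Omega> g a b l u has_real_derivative 0) (at \<zeta>) \<and>
     ereal (fiber s \<Omega> g a b l u \<zeta>) = (INF \<rho> \<in> {0<..}. ereal (fiber s \<Omega> g a b l u \<rho>))))"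

definition lambda0_bar ::
    "real \<Rightarrow> (real ^ 'n) set \<Rightarrow> (real ^ 'n \<Rightarrow> real \<Rightarrow> real) \<Rightarrow> real \<Rightarrow> real \<Rightarrow> real" where
  "lambda0_bar s \<Omega> g a b = (INF u \<in> X0_nonzero s \<Omega>. lambda0 s \<Omega> g a b u)"

end

theory Submission
  imports Defs
begin

text \<open>
  Testing the equation with \<open>v = u\<close> reduces nonexistence to a one-variable inequality: with
  \<open>t = \<parallel>u\<parallel>\<close>, the condition on \<open>a\<close> and \<open>b\<close> is, by Young's inequality, exactly what makes
  \<open>a t\<^sup>2 + b t\<^sup>4 - S\<^sup>-\<^sup>q\<^sup>/\<^sup>2 t\<^sup>q \<ge> d (t\<^sup>2 + t\<^sup>4)\<close> hold for some \<open>d > 0\<close> (\<open>q = 2N/(N - 2s) < 4\<close>), whereas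
  \<open>g(x,u) u\<close> integrates to at most a multiple of \<open>t\<^sup>2 + t\<^sup>4\<close>.  Integrating the inequality in \<open>t\<close>
  bounds the quotient (energy at \<open>\<lambda> = 0\<close>) / (integral of \<open>G\<close>) below uniformly; \<open>\<lambda>\<^sub>0(u)\<close> is the minimum of this
  quotient along the ray through \<open>u\<close>, so its infimum over \<open>u\<close> is positive.

  That \<open>S > 0\<close> is the fractional Sobolev inequality.  For \<open>v \<ge> 0\<close> and \<open>U\<close> the integral of \<open>v\<^sup>q\<close>, the set
  where \<open>v > v(x)/2\<close> has measure at most \<open>m = 2\<^sup>q U / v(x)\<^sup>q\<close>, so half of a ball of measure \<open>2m\<close> around
  \<open>x\<close> consists of points \<open>y\<close> with \<open>v(x) - v(y) \<ge> v(x)/2\<close>.  This bounds \<open>v(x)\<^sup>q\<close> by a constant times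
  \<open>U\<^sup>2\<^sup>s\<^sup>/\<^sup>N\<close> times the inner Gagliardo integral at \<open>x\<close>; integrating in \<open>x\<close> gives
  \<open>U\<^sup>2\<^sup>/\<^sup>q \<le> C \<parallel>v\<parallel>\<^sup>2\<close>.
\<close>

subsection \<open>Fractional Sobolev inequality\<close>

text \<open>A countable cover by Borel sets of finite measure stays one after completion. Tonelli's
  theorem on the product of two completed Lebesgue measures, over which the Gagliardo integrals are
  taken, rests on this.\<close>

lemma sigma_finite_lebesgue: "sigma_finite_measure (lebesgue :: ('a::euclidean_space) measure)"
proof
  obtain A :: "'a set set" where "countable A" "A \<subseteq> sets lborel" "\<Union>A = space lborel"
      "\<forall>a\<in>A. emeasure lborel a \<noteq> \<infinity>"
    using lborel.sigma_finite_countable by blast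
  then show "\<exists>A::'a set set. countable A \<and> A \<subseteq> sets lebesgue \<and> \<Union>A = space lebesgue
      \<and> (\<forall>a\<in>A. emeasure lebesgue a \<noteq> \<infinity>)"
    by (intro exI[of _ A]) auto
qed

interpretation lebesgue: sigma_finite_measure "lebesgue :: ('a::euclidean_space) measure"
  by (rule sigma_finite_lebesgue)

interpretation lebesgue2: pair_sigma_finite "lebesgue :: ('a::euclidean_space) measure"
    "lebesgue :: ('b::euclidean_space) measure" ..

lemma measurable_lebesgue_ident [measurable]:
  "(\<lambda>x. x) \<in> borel_measurable (lebesgue :: ('a::euclidean_space) measure)"
  by (rule measurable_completion) simp

lemma power2_powr: "0 \<le> x \<Longrightarrow> (x\<^sup>2) powr e = x powr (2 * e)" for x e :: real
  by (cases "x = 0") (simp_all add: powr_powr flip: powr_numeral)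

lemma powr_power2: "(x powr e)\<^sup>2 = x powr (2 * e)" for x e :: real
  by (simp add: power2_eq_square flip: powr_add)

text \<open>The ball around \<open>x\<close> of measure \<open>2 * m\<close> keeps measure at least
  \<open>m\<close> after \<open>E\<close> is removed, and there the kernel is at least its value at
  the radius \<open>r\<close> of the ball.\<close>

lemma nn_integral_power_kernel_ge:
  fixes x :: "real ^ 'n" and E :: "(real ^ 'n) set"
  assumes E [measurable]: "E \<in> sets lebesgue" and Em: "emeasure lebesgue E \<le> ennreal m"
    and m: "0 < m" and \<beta>: "0 < \<beta>"
  shows "ennreal (m / (2 * m / unit_ball_vol (real CARD('n))) powr (\<beta> / real CARD('n)))
    \<le> (\<integral>\<^sup>+y. indicator (- E) y * ennreal (1 / norm (x - y) powr \<beta>) \<partial>lebesgue)"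
proof -
  define \<omega> where "\<omega> = unit_ball_vol (real CARD('n))"
  have \<omega>: "\<omega> > 0" unfolding \<omega>_def by simp
  define r where "r = (2 * m / \<omega>) powr (1 / real CARD('n))"
  have r: "r > 0" unfolding r_def using m \<omega> by simp
  have rN: "r ^ CARD('n) = 2 * m / \<omega>"
    using m \<omega> r by (simp add: r_def powr_realpow[symmetric] powr_powr)
  have r\<beta>: "r powr \<beta> = (2 * m / \<omega>) powr (\<beta> / real CARD('n))"
    unfolding r_def by (simp add: powr_powr)
  \<comment> \<open>The centre is removed because the quotient is \<open>1 / 0 = 0\<close> at
    \<open>y = x\<close>, where the lower bound for the kernel fails.\<close>
  define B where "B = ball x r - E - {x}"
  have B [measurable]: "B \<in> sets lebesgue" unfolding B_def
    by (intro sets.Diff E) auto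
  have "ennreal (2 * m) = emeasure lebesgue (ball x r)"
    using r rN \<omega> by (simp add: emeasure_ball \<omega>_def[symmetric])
  also have "\<dots> \<le> emeasure lebesgue (B \<union> E \<union> {x})"
  proof (rule emeasure_mono)
    show "B \<union> E \<union> {x} \<in> sets lebesgue" by (intro sets.Un B E) simp
  qed (auto simp: B_def)
  also have "\<dots> \<le> emeasure lebesgue (B \<union> E) + emeasure lebesgue {x}"
    by (rule emeasure_subadditive) auto
  also have "\<dots> \<le> emeasure lebesgue B + emeasure lebesgue E"
    using emeasure_subadditive[of B lebesgue E] by auto
  also have "\<dots> \<le> emeasure lebesgue B + ennreal m"
    using Em by (rule add_left_mono)
  finally have "ennreal m + ennreal m \<le> emeasure lebesgue B + ennreal m"
    using m by (simp add: ennreal_plus[symmetric] del: ennreal_plus)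
  then have mB: "ennreal m \<le> emeasure lebesgue B"
    by (simp add: ennreal_add_left_cancel_le add.commute)
  have "ennreal (m / r powr \<beta>) = ennreal (1 / r powr \<beta>) * ennreal m"
    using m by (simp add: ennreal_mult[symmetric])
  also have "\<dots> \<le> ennreal (1 / r powr \<beta>) * emeasure lebesgue B"
    using mB by (rule mult_left_mono) simp
  also have "\<dots> = (\<integral>\<^sup>+y. ennreal (1 / r powr \<beta>) * indicator B y \<partial>lebesgue)"
    by (simp add: nn_integral_cmult_indicator)
  also have "\<dots> \<le> (\<integral>\<^sup>+y. indicator (- E) y * ennreal (1 / norm (x - y) powr \<beta>) \<partial>lebesgue)"
  proof (rule nn_integral_mono)
    fix y
    show "ennreal (1 / r powr \<beta>) * indicator B y
      \<le> indicator (- E) y * ennreal (1 / norm (x - y) powr \<beta>)"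
    proof (cases "y \<in> B")
      case True
      then have "0 < norm (x - y)" "norm (x - y) \<le> r" "y \<notin> E"
        by (auto simp: B_def dist_norm)
      then have "1 / r powr \<beta> \<le> 1 / norm (x - y) powr \<beta>"
        using \<beta> by (intro divide_left_mono powr_mono2 mult_pos_pos) auto
      with True \<open>y \<notin> E\<close> show ?thesis by (simp add: ennreal_leI)
    qed simp
  qed
  finally show ?thesis unfolding r\<beta> \<omega>_def .
qed

text \<open>The factors come from the pointwise bound with k = v(x): 4 from
  \<open>(k / 2)\<^sup>2\<close>, the power of \<open>2 / unit_ball_vol N\<close> from the radius of
  the ball of measure 2m, and the last power of 2 from m = 2^q U / k^q raised to 2s/N. The type
  argument carries the dimension.\<close>

definition sobolev_factor :: "'n itself \<Rightarrow> real \<Rightarrow> real" where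
  "sobolev_factor _ s = (let N = real CARD('n) in
     4 * (2 / unit_ball_vol N) powr (1 + 2 * s / N) *
       2 powr (2 * s * crit_exp N s / N))"

lemma sobolev_factor_pos: "sobolev_factor TYPE('n) s > 0"
  unfolding sobolev_factor_def Let_def
  by (intro mult_pos_pos) (auto simp: unit_ball_vol_pos less_imp_neq[OF unit_ball_vol_pos, symmetric])

text \<open>Chebyshev's inequality bounds the set where \<open>v > v x / 2\<close>; off that set the increment from
  \<open>x\<close> is at least \<open>v x / 2\<close>.\<close>

lemma gagliardo_pointwise_ge:
  fixes v :: "real ^ 'n \<Rightarrow> real" and x :: "real ^ 'n"
  assumes s: "0 < s" and N: "real CARD('n) > 4 * s"
    and v [measurable]: "v \<in> borel_measurable lebesgue" and v0: "\<And>y. 0 \<le> v y"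
    and U: "(\<integral>\<^sup>+y. ennreal (v y powr crit_exp (real CARD('n)) s) \<partial>lebesgue) = ennreal U" "U > 0"
  shows "ennreal (v x powr crit_exp (real CARD('n)) s) \<le>
    ennreal (sobolev_factor TYPE('n) s * U powr (2 * s / real CARD('n))) *
    (\<integral>\<^sup>+y. ennreal ((v x - v y)\<^sup>2 / norm (x - y) powr (real CARD('n) + 2 * s)) \<partial>lebesgue)"
proof (cases "v x = 0")
  case False
  define n where "n = real CARD('n)"
  define q where "q = crit_exp n s"
  define k where "k = v x"
  define \<omega> where "\<omega> = unit_ball_vol n"
  have k: "k > 0" using False v0[of x] by (simp add: k_def)
  have n: "n > 0" "n > 4 * s" using N by (auto simp: n_def)
  have q: "q > 0" unfolding q_def crit_exp_def using n s by simp
  have \<omega>: "\<omega> > 0" unfolding \<omega>_def using n by simp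
  define E where "E = {y. k / 2 < v y}"
  have E [measurable]: "E \<in> sets lebesgue" 
    using borel_measurable_less[of "\<lambda>_. k / 2" lebesgue v] by (simp add: E_def)
  define m where "m = U / (k / 2) powr q"
  have m: "m > 0" unfolding m_def using U k by simp
  have "ennreal ((k / 2) powr q) * emeasure lebesgue E
      = (\<integral>\<^sup>+y. ennreal ((k / 2) powr q) * indicator E y \<partial>lebesgue)"
    by (simp add: nn_integral_cmult_indicator)
  also have "\<dots> \<le> (\<integral>\<^sup>+y. ennreal (v y powr q) \<partial>lebesgue)"
    using k q by (intro nn_integral_mono) (auto simp: E_def indicator_def intro!: ennreal_leI powr_mono2)
  also have "\<dots> = ennreal U" using U by (simp add: q_def n_def)
  finally have *: "ennreal ((k / 2) powr q) * emeasure lebesgue E \<le> ennreal U" .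
  have "emeasure lebesgue E = ennreal (1 / (k / 2) powr q) * (ennreal ((k / 2) powr q) * emeasure lebesgue E)"
    using k by (simp add: mult.assoc[symmetric] ennreal_mult[symmetric])
  also have "\<dots> \<le> ennreal (1 / (k / 2) powr q) * ennreal U"
    by (rule mult_left_mono[OF *]) simp
  also have "\<dots> = ennreal m" using U by (simp add: m_def ennreal_mult[symmetric])
  finally have Em: "emeasure lebesgue E \<le> ennreal m" .
  define J where "J = (\<integral>\<^sup>+y. indicator (- E) y * ennreal (1 / norm (x - y) powr (n + 2 * s)) \<partial>lebesgue)"
  have J: "ennreal (m / (2 * m / \<omega>) powr ((n + 2 * s) / n)) \<le> J"
    using nn_integral_power_kernel_ge[OF E Em m, of "n + 2 * s" x] n s
    by (simp add: n_def \<omega>_def J_def)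
  define I where "I = (\<integral>\<^sup>+y. ennreal ((v x - v y)\<^sup>2 / norm (x - y) powr (n + 2 * s)) \<partial>lebesgue)"
  have "ennreal ((k / 2)\<^sup>2) * J
      = (\<integral>\<^sup>+y. ennreal ((k / 2)\<^sup>2) * (indicator (- E) y * ennreal (1 / norm (x - y) powr (n + 2 * s))) \<partial>lebesgue)"
    unfolding J_def by (rule nn_integral_cmult[symmetric]) measurable
  also have "\<dots> \<le> I"
    unfolding I_def
  proof (rule nn_integral_mono)
    fix y
    have "(k / 2)\<^sup>2 \<le> (v x - v y)\<^sup>2" if "y \<notin> E"
      using that k v0[of y] by (intro power_mono) (auto simp: E_def k_def)
    then have "(k / 2)\<^sup>2 / norm (x - y) powr (n + 2 * s) \<le> (v x - v y)\<^sup>2 / norm (x - y) powr (n + 2 * s)"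
      if "y \<notin> E" using that by (intro divide_right_mono) auto
    then show "ennreal ((k / 2)\<^sup>2) * (indicator (- E) y * ennreal (1 / norm (x - y) powr (n + 2 * s)))
      \<le> ennreal ((v x - v y)\<^sup>2 / norm (x - y) powr (n + 2 * s))"
      by (cases "y \<in> E") (auto simp: ennreal_mult[symmetric] intro!: ennreal_leI)
  qed
  finally have JI: "ennreal ((k / 2)\<^sup>2) * J \<le> I" .
  define c where "c = sobolev_factor TYPE('n) s * U powr (2 * s / n)"
  have c: "c > 0" unfolding c_def using sobolev_factor_pos[where 'n='n] U by simp
  \<comment> \<open>This is where the critical exponent enters: q = 2 + 2sq/n, so k^2 from the
    increments and k^(2sq/n) from \<open>m\<close> combine to exactly k^q. The constant
    \<open>c\<close> is chosen to make this an equality.\<close>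
  have e: "k powr q = c * ((k / 2)\<^sup>2 * (m / (2 * m / \<omega>) powr ((n + 2 * s) / n)))"
  proof -
    have qe: "q = 2 + q * (2 * s / n)"
      unfolding q_def crit_exp_def using n s by (simp add: field_simps)
    have "(2 * m / \<omega>) powr ((n + 2 * s) / n) = (2 / \<omega>) powr (1 + 2 * s / n) * m powr (1 + 2 * s / n)"
      using m \<omega> n by (simp add: powr_mult[symmetric] add_divide_distrib)
    also have "m powr (1 + 2 * s / n) = m * m powr (2 * s / n)"
      using m by (simp add: powr_add)
    also have "m powr (2 * s / n) = U powr (2 * s / n) * 2 powr (q * (2 * s / n)) / k powr (q * (2 * s / n))"
      unfolding m_def using U k by (simp add: powr_divide powr_powr powr_mult)
    finally have 1: "m / (2 * m / \<omega>) powr ((n + 2 * s) / n) =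
       k powr (q * (2 * s / n)) / ((2 / \<omega>) powr (1 + 2 * s / n) * U powr (2 * s / n) * 2 powr (q * (2 * s / n)))"
      using m k U \<omega> by (simp add: field_simps)
    have "k powr q = k powr (2 + q * (2 * s / n))" using qe by simp
    also have "\<dots> = k\<^sup>2 * k powr (q * (2 * s / n))"
      using k by (simp add: powr_add powr_numeral)
    finally have 2: "k powr q = k\<^sup>2 * k powr (q * (2 * s / n))" .
    have 3: "c = 4 * (2 / \<omega>) powr (1 + 2 * s / n) * 2 powr (q * (2 * s / n)) * U powr (2 * s / n)"
      unfolding c_def sobolev_factor_def Let_def \<omega>_def n_def[symmetric] q_def[symmetric]
      by (simp add: mult_ac)
    have nz: "(2 / \<omega>) powr (1 + 2 * s / n) \<noteq> 0" "U powr (2 * s / n) \<noteq> 0" "2 powr (q * (2 * s / n)) \<noteq> 0"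
      using \<omega> U by auto
    show ?thesis unfolding 1 2 3 using nz by (simp add: field_simps power2_eq_square)
  qed
  have "ennreal (k powr q) = ennreal c * (ennreal ((k / 2)\<^sup>2) * ennreal (m / (2 * m / \<omega>) powr ((n + 2 * s) / n)))"
    unfolding e using c m by (subst ennreal_mult, simp, simp)+ simp
  also have "\<dots> \<le> ennreal c * (ennreal ((k / 2)\<^sup>2) * J)"
    by (intro mult_left_mono J) auto
  also have "\<dots> \<le> ennreal c * I"
    by (intro mult_left_mono JI) auto
  finally show ?thesis
    by (simp add: c_def I_def n_def q_def k_def)
qed simp

section \<open>The norm of the function space and the integrated Sobolev inequality\<close>

lemma crit_exp_bounds:
  assumes "0 < s" "n > 4 * s"
  shows "2 < crit_exp n s" "crit_exp n s < 4"
  using assms by (auto simp: crit_exp_def field_simps)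

lemma X0_inner_self_nonneg: "0 \<le> X0_inner s \<Omega> u u"
  unfolding X0_inner_def set_lebesgue_integral_def
  by (rule integral_nonneg_AE) (auto simp: zero_le_mult_iff)

lemma X0_norm_nonneg [simp]: "0 \<le> X0_norm s \<Omega> u"
  by (simp add: X0_norm_def X0_inner_self_nonneg)

lemma X0_norm_sq: "(X0_norm s \<Omega> u)\<^sup>2 = X0_inner s \<Omega> u u"
  by (simp add: X0_norm_def X0_inner_self_nonneg)

text \<open>The product of \<Omega> with the whole space lies inside
  \<open>Q_region \<Omega>\<close> and the integrand is nonnegative; Tonelli's theorem then turns
  the iterated integral into part of the squared norm.\<close>

lemma nn_integral_gagliardo_le:
  fixes \<Omega> :: "(real ^ 'n) set"
  assumes \<Omega> [measurable]: "\<Omega> \<in> sets lebesgue" and u: "u \<in> X0_space s \<Omega>"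
  shows "(\<integral>\<^sup>+x. indicator \<Omega> x *
      (\<integral>\<^sup>+y. ennreal ((u x - u y)\<^sup>2 / norm (x - y) powr (real CARD('n) + 2 * s)) \<partial>lebesgue) \<partial>lebesgue)
    \<le> ennreal ((X0_norm s \<Omega> u)\<^sup>2)"
proof -
  define k where "k = (\<lambda>z. (u (fst z) - u (snd z))\<^sup>2 / norm (fst z - snd z) powr (real CARD('n) + 2 * s))"
  have um [measurable]: "u \<in> borel_measurable lebesgue" using u by (simp add: X0_space_def)
  have km [measurable]: "k \<in> borel_measurable (lebesgue \<Otimes>\<^sub>M lebesgue)"
    unfolding k_def by measurable
  have int: "integrable (lebesgue \<Otimes>\<^sub>M lebesgue) (\<lambda>z. indicator (Q_region \<Omega>) z * k z)"
    using u by (simp add: X0_space_def set_integrable_def k_def case_prod_unfold)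
  have "(\<integral>\<^sup>+x. indicator \<Omega> x *
      (\<integral>\<^sup>+y. ennreal ((u x - u y)\<^sup>2 / norm (x - y) powr (real CARD('n) + 2 * s)) \<partial>lebesgue) \<partial>lebesgue)
    = (\<integral>\<^sup>+x. (\<integral>\<^sup>+y. indicator \<Omega> x * ennreal (k (x, y)) \<partial>lebesgue) \<partial>lebesgue)"
    by (intro nn_integral_cong, subst nn_integral_cmult) (auto simp: k_def)
  also have "\<dots> = (\<integral>\<^sup>+z. indicator \<Omega> (fst z) * ennreal (k z) \<partial>(lebesgue \<Otimes>\<^sub>M lebesgue))"
    by (subst lebesgue.nn_integral_fst[symmetric]) auto
  also have "\<dots> \<le> (\<integral>\<^sup>+z. ennreal (indicator (Q_region \<Omega>) z * k z) \<partial>(lebesgue \<Otimes>\<^sub>M lebesgue))"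
    by (intro nn_integral_mono) (auto simp: Q_region_def indicator_def)
  also have "\<dots> = ennreal (\<integral>z. indicator (Q_region \<Omega>) z * k z \<partial>(lebesgue \<Otimes>\<^sub>M lebesgue))"
    by (rule nn_integral_eq_integral[OF int]) (auto simp: k_def)
  also have "\<dots> = ennreal ((X0_norm s \<Omega> u)\<^sup>2)"
    unfolding X0_norm_sq X0_inner_def set_lebesgue_integral_def
    by (simp add: k_def case_prod_unfold power2_eq_square)
  finally show ?thesis .
qed

text \<open>Truncation makes the \<open>L\<^sup>q\<close> norm finite, so that its power on the right-hand side of the
  pointwise bound can be absorbed.\<close>

lemma sobolev_truncated:
  fixes \<Omega> :: "(real ^ 'n) set"
  assumes s: "0 < s" and N: "real CARD('n) > 4 * s"
    and \<Omega> [measurable]: "\<Omega> \<in> sets lebesgue" and bd: "bounded \<Omega>"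
    and u: "u \<in> X0_space s \<Omega>" and M: "0 \<le> M"
  shows "(\<integral>\<^sup>+x. ennreal ((indicator \<Omega> x * min \<bar>u x\<bar> M) powr crit_exp (real CARD('n)) s) \<partial>lebesgue)
    \<le> ennreal ((sobolev_factor TYPE('n) s * (X0_norm s \<Omega> u)\<^sup>2) powr (crit_exp (real CARD('n)) s / 2))"
proof -
  define n where "n = real CARD('n)"
  define q where "q = crit_exp n s"
  define v where "v = (\<lambda>x. indicator \<Omega> x * min \<bar>u x\<bar> M)"
  define c where "c = sobolev_factor TYPE('n) s"
  define E where "E = (X0_norm s \<Omega> u)\<^sup>2"
  have c: "c > 0" unfolding c_def by (rule sobolev_factor_pos)
  have q: "q > 2" using crit_exp_bounds[OF s N] by (simp add: q_def n_def)
  have um [measurable]: "u \<in> borel_measurable lebesgue" using u by (simp add: X0_space_def)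
  have vm [measurable]: "v \<in> borel_measurable lebesgue" unfolding v_def by measurable
  have v0: "0 \<le> v y" for y using M by (simp add: v_def)
  have vM: "v y \<le> M * indicator \<Omega> y" for y using M by (simp add: v_def indicator_def)
  define I where "I = (\<integral>\<^sup>+x. ennreal (v x powr q) \<partial>lebesgue)"
  have "I \<le> (\<integral>\<^sup>+x. ennreal (M powr q) * indicator \<Omega> x \<partial>lebesgue)"
    unfolding I_def
    using M q v0 by (intro nn_integral_mono) (auto simp: v_def indicator_def intro!: ennreal_leI powr_mono2)
  also have "\<dots> = ennreal (M powr q) * emeasure lebesgue \<Omega>"
    by (simp add: nn_integral_cmult_indicator)
  also have "\<dots> < \<infinity>"
    using bounded_set_imp_lmeasurable[OF bd \<Omega>] by (simp add: fmeasurable_def ennreal_mult_less_top)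
  finally have Ifin: "I < \<infinity>" .
  define U where "U = enn2real I"
  have IU: "I = ennreal U" using Ifin by (simp add: U_def)
  have "I \<le> ennreal ((c * E) powr (q / 2))"
  proof (cases "U > 0")
    case True
    have AEu: "AE y in lebesgue. y \<notin> \<Omega> \<longrightarrow> u y = 0" using u by (simp add: X0_space_def)
    have "I \<le> (\<integral>\<^sup>+x. ennreal (c * U powr (2 * s / n)) * (indicator \<Omega> x *
      (\<integral>\<^sup>+y. ennreal ((u x - u y)\<^sup>2 / norm (x - y) powr (n + 2 * s)) \<partial>lebesgue)) \<partial>lebesgue)"
      unfolding I_def
    proof (rule nn_integral_mono)
      fix x
      show "ennreal (v x powr q) \<le> ennreal (c * U powr (2 * s / n)) * (indicator \<Omega> x *
        (\<integral>\<^sup>+y. ennreal ((u x - u y)\<^sup>2 / norm (x - y) powr (n + 2 * s)) \<partial>lebesgue))"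
      proof (cases "x \<in> \<Omega>")
        case xin: True
        have "ennreal (v x powr q) \<le> ennreal (c * U powr (2 * s / n)) *
            (\<integral>\<^sup>+y. ennreal ((v x - v y)\<^sup>2 / norm (x - y) powr (n + 2 * s)) \<partial>lebesgue)"
          using gagliardo_pointwise_ge[OF s N vm v0 _ True, of x] IU
          by (simp add: I_def c_def q_def n_def)
        also have "\<dots> \<le> ennreal (c * U powr (2 * s / n)) *
            (\<integral>\<^sup>+y. ennreal ((u x - u y)\<^sup>2 / norm (x - y) powr (n + 2 * s)) \<partial>lebesgue)"
        proof (intro mult_left_mono nn_integral_mono_AE)
          show "AE y in lebesgue. ennreal ((v x - v y)\<^sup>2 / norm (x - y) powr (n + 2 * s))
             \<le> ennreal ((u x - u y)\<^sup>2 / norm (x - y) powr (n + 2 * s))"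
            using AEu
          proof eventually_elim
            case (elim y)
            \<comment> \<open>The map t to min |t| M is 1-Lipschitz, which settles \<open>y\<close>
              in \<Omega>. Outside \<Omega>, \<open>v y\<close> is 0 and so is \<open>u y\<close>
              for almost every \<open>y\<close>.\<close>
            have "\<bar>v x - v y\<bar> \<le> \<bar>u x - u y\<bar>"
              using elim xin M by (auto simp: v_def indicator_def)
            then have "(v x - v y)\<^sup>2 \<le> (u x - u y)\<^sup>2" by (simp add: abs_le_square_iff)
            then show ?case by (intro ennreal_leI divide_right_mono) auto
          qed
        qed simp
        finally show ?thesis using xin by simp
      qed (simp add: v_def)
    qed
    also have "\<dots> = ennreal (c * U powr (2 * s / n)) * (\<integral>\<^sup>+x. (indicator \<Omega> x *
      (\<integral>\<^sup>+y. ennreal ((u x - u y)\<^sup>2 / norm (x - y) powr (n + 2 * s)) \<partial>lebesgue)) \<partial>lebesgue)"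
      by (rule nn_integral_cmult) measurable
    also have "\<dots> \<le> ennreal (c * U powr (2 * s / n)) * ennreal E"
      unfolding E_def n_def by (intro mult_left_mono nn_integral_gagliardo_le[OF \<Omega> u]) simp
    finally have "U \<le> c * U powr (2 * s / n) * E"
      using c True unfolding IU by (simp add: ennreal_mult[symmetric] E_def)
    \<comment> \<open>Since U is positive and finite, its power can be absorbed on the left; 1 -
      2s/n = 2/q identifies what remains.\<close>
    then have "U / U powr (2 * s / n) \<le> c * E" using True by (simp add: field_simps)
    moreover have "U / U powr (2 * s / n) = U powr (2 / q)"
    proof -
      have "2 / q = 1 - 2 * s / n" using N s
        by (simp add: q_def crit_exp_def n_def field_simps)
      then show ?thesis using True by (simp add: powr_diff)
    qed
    ultimately have "U powr (2 / q) \<le> c * E" by simp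
    then have "(U powr (2 / q)) powr (q / 2) \<le> (c * E) powr (q / 2)"
      using q by (intro powr_mono2) auto
    then have "U \<le> (c * E) powr (q / 2)"
      using True q by (simp add: powr_powr)
    then show ?thesis unfolding IU by (rule ennreal_leI)
  next
    case False
    then show ?thesis unfolding IU by (simp add: ennreal_neg)
  qed
  then show ?thesis by (simp add: I_def v_def c_def E_def q_def n_def)
qed

text \<open>The bound for truncations does not depend on the level, so monotone convergence carries
  it to \<open>u\<close>.\<close>

lemma sobolev_nn_integral:
  fixes \<Omega> :: "(real ^ 'n) set"
  assumes s: "0 < s" and N: "real CARD('n) > 4 * s"
    and \<Omega> [measurable]: "\<Omega> \<in> sets lebesgue" and bd: "bounded \<Omega>"
    and u: "u \<in> X0_space s \<Omega>"
  shows "(\<integral>\<^sup>+x. ennreal (\<bar>u x\<bar> powr crit_exp (real CARD('n)) s) \<partial>lebesgue_on \<Omega>)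
    \<le> ennreal ((sobolev_factor TYPE('n) s * (X0_norm s \<Omega> u)\<^sup>2) powr (crit_exp (real CARD('n)) s / 2))"
proof -
  define q where "q = crit_exp (real CARD('n)) s"
  have q: "q > 2" using crit_exp_bounds[OF s N] by (simp add: q_def)
  have um [measurable]: "u \<in> borel_measurable lebesgue" using u by (simp add: X0_space_def)
  let ?v = "\<lambda>k x. ennreal ((indicator \<Omega> x * min \<bar>u x\<bar> (real k)) powr q)"
  have "(\<lambda>k. \<integral>\<^sup>+x. ?v k x \<partial>lebesgue) \<longlonglongrightarrow> (\<integral>\<^sup>+x. ennreal ((indicator \<Omega> x * \<bar>u x\<bar>) powr q) \<partial>lebesgue)"
  proof (rule nn_integral_LIMSEQ)
    show "mono ?v"
      using q by (intro monoI le_funI ennreal_leI powr_mono2 mult_left_mono) auto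
    show "?v k \<in> borel_measurable lebesgue" for k by measurable
    fix x
    obtain K :: nat where K: "\<bar>u x\<bar> \<le> real K" using real_arch_simple by blast
    have "eventually (\<lambda>k. ?v k x = ennreal ((indicator \<Omega> x * \<bar>u x\<bar>) powr q)) sequentially"
      using eventually_ge_at_top[of K] by eventually_elim (use K in \<open>auto simp: min_def\<close>)
    then show "(\<lambda>k. ?v k x) \<longlonglongrightarrow> ennreal ((indicator \<Omega> x * \<bar>u x\<bar>) powr q)"
      by (rule tendsto_eventually)
  qed
  then have "(\<integral>\<^sup>+x. ennreal ((indicator \<Omega> x * \<bar>u x\<bar>) powr q) \<partial>lebesgue)
      \<le> ennreal ((sobolev_factor TYPE('n) s * (X0_norm s \<Omega> u)\<^sup>2) powr (q / 2))"
    by (rule LIMSEQ_le_const2) (use sobolev_truncated[OF s N \<Omega> bd u] in \<open>auto simp: q_def\<close>)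
  moreover have "(\<integral>\<^sup>+x. ennreal (\<bar>u x\<bar> powr q) \<partial>lebesgue_on \<Omega>)
     = (\<integral>\<^sup>+x. ennreal ((indicator \<Omega> x * \<bar>u x\<bar>) powr q) \<partial>lebesgue)"
    by (subst nn_integral_restrict_space) (auto intro!: nn_integral_cong simp: indicator_def)
  ultimately show ?thesis by (simp add: q_def)
qed

text \<open>Membership in \<open>X0_space\<close> provides only square integrability. The Bochner
  integral of a nonintegrable function is 0 by default, so integrability of the critical power has
  to be known before \<open>Lq_norm\<close> has its intended meaning.\<close>

lemma sobolev_integrable:
  fixes \<Omega> :: "(real ^ 'n) set"
  assumes s: "0 < s" and N: "real CARD('n) > 4 * s"
    and \<Omega> [measurable]: "\<Omega> \<in> sets lebesgue" and bd: "bounded \<Omega>"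
    and u: "u \<in> X0_space s \<Omega>"
  shows "integrable (lebesgue_on \<Omega>) (\<lambda>x. \<bar>u x\<bar> powr crit_exp (real CARD('n)) s)"
proof -
  have um [measurable]: "u \<in> borel_measurable (lebesgue_on \<Omega>)"
    using u by (auto simp: X0_space_def intro: measurable_restrict_space1)
  show ?thesis
    by (rule integrableI_nonneg)
      (use le_less_trans[OF sobolev_nn_integral[OF s N \<Omega> bd u] ennreal_less_top] in auto)
qed

lemma sobolev_inequality:
  fixes \<Omega> :: "(real ^ 'n) set"
  assumes s: "0 < s" and N: "real CARD('n) > 4 * s"
    and \<Omega> [measurable]: "\<Omega> \<in> sets lebesgue" and bd: "bounded \<Omega>"
    and u: "u \<in> X0_space s \<Omega>"
  shows "(Lq_norm \<Omega> (crit_exp (real CARD('n)) s) u)\<^sup>2 \<le> sobolev_factor TYPE('n) s * (X0_norm s \<Omega> u)\<^sup>2"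
proof -
  define q where "q = crit_exp (real CARD('n)) s"
  define E where "E = sobolev_factor TYPE('n) s * (X0_norm s \<Omega> u)\<^sup>2"
  have q: "q > 2" using crit_exp_bounds[OF s N] by (simp add: q_def)
  define J where "J = (LINT x|lebesgue_on \<Omega>. \<bar>u x\<bar> powr q)"
  have "ennreal J = (\<integral>\<^sup>+x. ennreal (\<bar>u x\<bar> powr q) \<partial>lebesgue_on \<Omega>)"
    unfolding J_def q_def by (rule nn_integral_eq_integral[symmetric, OF sobolev_integrable[OF assms]]) simp
  also have "\<dots> \<le> ennreal (E powr (q / 2))"
    using sobolev_nn_integral[OF assms] by (simp add: q_def E_def)
  finally have J: "J \<le> E powr (q / 2)" by (simp add: ennreal_le_iff)
  have J0: "J \<ge> 0" by (simp add: J_def)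
  have E0: "E \<ge> 0" unfolding E_def using sobolev_factor_pos[where 'n='n, of s] by simp
  have "(J powr (1 / q))\<^sup>2 = J powr (2 / q)"
    by (simp add: powr_power2)
  also have "\<dots> \<le> (E powr (q / 2)) powr (2 / q)"
    using J J0 q by (intro powr_mono2) auto
  also have "\<dots> = E" using q E0 by (simp add: powr_powr)
  finally show ?thesis by (simp add: Lq_norm_def J_def q_def E_def)
qed

subsection \<open>Coercivity of the Kirchhoff energy\<close>

text \<open>Weighted AM-GM with weights 1 - \<theta> and \<theta> gives L t^(2\<theta>) \<le> a + b
  t^2, where \<open>L\<close> is the right-hand side of the assumption on \<open>K\<close>. Hence
  the K-term uses up at most the fraction K/L of a t^2 + b t^4, and the strict gap K < L leaves a
  positive \<open>d\<close>.\<close>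

lemma kirchhoff_young:
  fixes a b K \<theta> :: real
  assumes "0 < a" "0 < b" "0 \<le> K" "0 < \<theta>" "\<theta> < 1"
    and K: "K < (a / (1 - \<theta>)) powr (1 - \<theta>) * (b / \<theta>) powr \<theta>"
  obtains d where "0 < d" "\<And>t. 0 \<le> t \<Longrightarrow> d * (t\<^sup>2 + t ^ 4) \<le> a * t\<^sup>2 + b * t ^ 4 - K * t powr (2 + 2 * \<theta>)"
proof -
  define L where "L = (a / (1 - \<theta>)) powr (1 - \<theta>) * (b / \<theta>) powr \<theta>"
  have L: "L > 0" "K < L" unfolding L_def using assms by auto
  define d where "d = (1 - K / L) * min a b"
  show ?thesis
  proof
    show "0 < d" unfolding d_def using L assms by (intro mult_pos_pos) auto
    fix t :: real assume "0 \<le> t"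
    show "d * (t\<^sup>2 + t ^ 4) \<le> a * t\<^sup>2 + b * t ^ 4 - K * t powr (2 + 2 * \<theta>)"
    proof (cases "t = 0")
      case False
      with \<open>0 \<le> t\<close> have t: "t > 0" by simp
      have "(a / (1 - \<theta>)) powr (1 - \<theta>) * (b * t\<^sup>2 / \<theta>) powr \<theta>
          \<le> (1 - \<theta>) * (a / (1 - \<theta>)) + \<theta> * (b * t\<^sup>2 / \<theta>)"
        by (rule Youngs_inequality_0) (use assms t in auto)
      also have "\<dots> = a + b * t\<^sup>2" using assms by simp
      also have "(b * t\<^sup>2 / \<theta>) powr \<theta> = (b / \<theta>) powr \<theta> * t powr (2 * \<theta>)"
      proof -
        have "t powr (2 * \<theta>) = (t\<^sup>2) powr \<theta>" using t by (simp add: power2_powr)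
        moreover have "(b / \<theta> * t\<^sup>2) powr \<theta> = (b / \<theta>) powr \<theta> * (t\<^sup>2) powr \<theta>"
          using assms t by (intro powr_mult)
        ultimately show ?thesis by simp
      qed
      finally have Y: "L * t powr (2 * \<theta>) \<le> a + b * t\<^sup>2" by (simp add: L_def mult.assoc)
      have "K * t powr (2 * \<theta>) = K / L * (L * t powr (2 * \<theta>))" using L by simp
      also have "\<dots> \<le> K / L * (a + b * t\<^sup>2)"
        using Y L assms by (intro mult_left_mono) auto
      finally have "K * t powr (2 * \<theta>) \<le> K / L * (a + b * t\<^sup>2)" .
      then have "t\<^sup>2 * (K * t powr (2 * \<theta>)) \<le> t\<^sup>2 * (K / L * (a + b * t\<^sup>2))"
        by (intro mult_left_mono) auto
      moreover have "t powr (2 + 2 * \<theta>) = t\<^sup>2 * t powr (2 * \<theta>)"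
        using t by (simp add: powr_add powr_numeral)
      ultimately have 1: "K * t powr (2 + 2 * \<theta>) \<le> K / L * (a * t\<^sup>2 + b * t ^ 4)"
        by (simp add: algebra_simps power4_eq_xxxx power2_eq_square)
      have "d * (t\<^sup>2 + t ^ 4) = (1 - K / L) * (min a b * t\<^sup>2 + min a b * t ^ 4)"
        by (simp add: d_def algebra_simps)
      also have "\<dots> \<le> (1 - K / L) * (a * t\<^sup>2 + b * t ^ 4)"
        using L by (intro mult_left_mono add_mono mult_right_mono) auto
      finally show ?thesis using 1 by (simp add: algebra_simps)
    qed simp
  qed
qed

text \<open>With \<theta> = 2s/(n - 2s) and e = (n - 4s)/(2s), so that e\<theta> = 1 - \<theta>, the
  assumption on a and b says S^(-n/(2s)) < (a/(1 - \<theta>))^e (b/\<theta>). Its \<theta>-th power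
  is the condition of \<open>kirchhoff_young\<close> for K = S^(-q/2), where q = 2 +
  2\<theta>.\<close>

lemma kirchhoff_coercive:
  fixes a b s n S :: real
  assumes s: "0 < s" "n > 4 * s" and ab: "0 < a" "0 < b" and S: "0 < S"
    and PS: "a powr ((n - 4 * s) / (2 * s)) * b > 2 * s * (n - 4 * s) powr ((n - 4 * s) / (2 * s)) /
     ((n - 2 * s) powr ((n - 2 * s) / (2 * s)) * S powr (n / (2 * s)))"
  obtains d where "0 < d" "\<And>t. 0 \<le> t \<Longrightarrow>
    d * (t\<^sup>2 + t ^ 4) \<le> a * t\<^sup>2 + b * t ^ 4 - S powr (- (crit_exp n s / 2)) * t powr crit_exp n s"
proof -
  define \<theta> where "\<theta> = 2 * s / (n - 2 * s)"
  define e where "e = (n - 4 * s) / (2 * s)"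
  have n: "n > 0" "n - 2 * s > 0" "n - 4 * s > 0" using s by auto
  have \<theta>: "0 < \<theta>" "\<theta> < 1" using s by (auto simp: \<theta>_def)
  have \<theta>1: "1 - \<theta> = (n - 4 * s) / (n - 2 * s)" using n by (simp add: \<theta>_def field_simps)
  have e1: "(n - 2 * s) / (2 * s) = e + 1" using s by (simp add: e_def field_simps)
  have "e * \<theta> = (n - 4 * s) / (n - 2 * s)" unfolding e_def \<theta>_def using s by simp
  then have e\<theta>: "e * \<theta> = 1 - \<theta>" by (simp add: \<theta>1)
  have q: "crit_exp n s = 2 + 2 * \<theta>" using n by (simp add: crit_exp_def \<theta>_def field_simps)
  define X where "X = (a / (1 - \<theta>)) powr e * (b / \<theta>)"
  have "S powr (- (n / (2 * s))) < X"
  proof -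
    have "X = a powr e * b * ((n - 2 * s) powr e * (n - 2 * s) / ((n - 4 * s) powr e * (2 * s)))"
      unfolding X_def \<theta>1 using n ab s by (simp add: \<theta>_def powr_divide powr_mult)
    also have "\<dots> = a powr e * b * ((n - 2 * s) powr (e + 1) / ((n - 4 * s) powr e * (2 * s)))"
      using n by (simp add: powr_add)
    also have "\<dots> > 2 * s * (n - 4 * s) powr e / ((n - 2 * s) powr (e + 1) * S powr (n / (2 * s))) *
        ((n - 2 * s) powr (e + 1) / ((n - 4 * s) powr e * (2 * s)))"
      using PS n s unfolding e1 e_def[symmetric] by (intro mult_strict_right_mono) auto
    also have "2 * s * (n - 4 * s) powr e / ((n - 2 * s) powr (e + 1) * S powr (n / (2 * s))) *
        ((n - 2 * s) powr (e + 1) / ((n - 4 * s) powr e * (2 * s))) = S powr (- (n / (2 * s)))"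
      using n s S by (simp add: powr_minus field_simps)
    finally show ?thesis .
  qed
  then have "(S powr (- (n / (2 * s)))) powr \<theta> < X powr \<theta>"
    using \<theta> by (intro powr_less_mono2) auto
  moreover have "(S powr (- (n / (2 * s)))) powr \<theta> = S powr (- (crit_exp n s / 2))"
  proof -
    have "crit_exp n s / 2 = n / (n - 2 * s)" using n by (simp add: crit_exp_def field_simps)
    moreover have "(S powr (- (n / (2 * s)))) powr \<theta> = S powr (- (n / (n - 2 * s)))"
      using s by (simp add: powr_powr \<theta>_def)
    ultimately show ?thesis by (simp only:)
  qed
  moreover have "X powr \<theta> = (a / (1 - \<theta>)) powr (1 - \<theta>) * (b / \<theta>) powr \<theta>"
    unfolding X_def powr_mult powr_powr e\<theta> ..
  ultimately have K: "S powr (- (crit_exp n s / 2)) < (a / (1 - \<theta>)) powr (1 - \<theta>) * (b / \<theta>) powr \<theta>"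
    by simp
  show ?thesis
  proof (rule kirchhoff_young[OF ab _ \<theta> K])
    fix d
    assume "0 < d" and "\<And>t. 0 \<le> t \<Longrightarrow> d * (t\<^sup>2 + t ^ 4)
      \<le> a * t\<^sup>2 + b * t ^ 4 - S powr (- (crit_exp n s / 2)) * t powr (2 + 2 * \<theta>)"
    then show thesis by (intro that[of d]) (simp_all add: q)
  qed simp
qed

text \<open>Passing from the tested equation to the energy is an integration in t: x times the
  derivative of \<open>F\<close> is the gap in the assumed inequality, so \<open>F\<close> increases
  from \<open>F 0 = 0\<close>. This yields d/2 t^2 + d/4 t^4, and the surplus d/4 t^2 is
  dropped.\<close>

lemma kirchhoff_coercive_primitive:
  fixes a b d K q t :: real
  assumes q: "2 < q" and "0 \<le> t" and d: "0 \<le> d"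
    and le: "\<And>t. 0 \<le> t \<Longrightarrow> d * (t\<^sup>2 + t ^ 4) \<le> a * t\<^sup>2 + b * t ^ 4 - K * t powr q"
  shows "d / 4 * (t\<^sup>2 + t ^ 4) \<le> a / 2 * t\<^sup>2 + b / 4 * t ^ 4 - K / q * t powr q"
proof -
  define F where "F = (\<lambda>t. a / 2 * t\<^sup>2 + b / 4 * t ^ 4 - K / q * t powr q - d / 2 * t\<^sup>2 - d / 4 * t ^ 4)"
  have "F 0 \<le> F t"
  proof (cases "t = 0")
    case False
    show ?thesis
    proof (rule DERIV_nonneg_imp_increasing_open[of 0 t F])
      show "0 \<le> t" by fact
      have "continuous_on {0..t} (\<lambda>t. t powr q)"
        by (rule continuous_on_powr') (use q in \<open>auto intro!: continuous_intros\<close>)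
      then show "continuous_on {0..t} F"
        unfolding F_def
        by (intro continuous_on_diff continuous_on_add continuous_on_mult continuous_on_power
            continuous_on_const continuous_on_id)
      fix x :: real assume x: "0 < x" "x < t"
      have "(F has_real_derivative
          (a * x + b * x ^ 3 - K * x powr (q - 1) - d * x - d * x ^ 3)) (at x)"
        unfolding F_def using x q
        by (auto intro!: derivative_eq_intros)
      moreover have "x * (a * x + b * x ^ 3 - K * x powr (q - 1) - d * x - d * x ^ 3)
          = a * x\<^sup>2 + b * x ^ 4 - K * x powr q - d * (x\<^sup>2 + x ^ 4)"
      proof -
        have "x powr q = x * x powr (q - 1)" using x by (simp add: powr_diff)
        then show ?thesis by (simp add: algebra_simps power2_eq_square power3_eq_cube power4_eq_xxxx)
      qed
      then have "0 \<le> x * (a * x + b * x ^ 3 - K * x powr (q - 1) - d * x - d * x ^ 3)"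
        using le[of x] x by simp
      then have "0 \<le> a * x + b * x ^ 3 - K * x powr (q - 1) - d * x - d * x ^ 3"
        using x by (simp add: zero_le_mult_iff)
      ultimately show "\<exists>y. (F has_real_derivative y) (at x) \<and> 0 \<le> y" by blast
    qed
  qed simp
  then have "d / 4 * (t\<^sup>2 + t ^ 4) + d / 4 * t\<^sup>2 \<le> a / 2 * t\<^sup>2 + b / 4 * t ^ 4 - K / q * t powr q"
    using q by (simp add: F_def field_simps)
  moreover have "0 \<le> d / 4 * t\<^sup>2" using d by simp
  ultimately show ?thesis by linarith
qed

subsection \<open>Nontriviality of the function space and the Sobolev constant\<close>

lemma dyadic_bracket:
  fixes t :: real assumes "1 \<le> t"
  obtains k :: nat where "2 ^ k \<le> t" "t < 2 ^ (k + 1)"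
proof -
  obtain m :: nat where m: "t < 2 ^ m" using real_arch_pow[of 2 t] by auto
  define l where "l = (LEAST m. t < 2 ^ m)"
  have l: "t < 2 ^ l" unfolding l_def by (rule LeastI[of _ m]) (rule m)
  have "l \<noteq> 0" using l assms by (intro notI) simp
  then obtain k where k: "l = Suc k" by (cases l) auto
  have "\<not> t < 2 ^ k" using not_less_Least[of k "\<lambda>m. t < 2 ^ m"] k by (auto simp: l_def)
  then show ?thesis using that[of k] l k by auto
qed

text \<open>Dyadic annuli around \<open>x\<close> contribute multiples of 2^(-2sk) at large distance
  and of 2^((2s - 2)k) at small distance. Both geometric series converge exactly because 0 < s < 1,
  and their sums do not depend on \<open>x\<close>.\<close>

lemma nn_integral_truncated_kernel_bounded:
  fixes s :: real
  assumes s: "0 < s" "s < 1"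
  obtains C where "\<And>x :: real ^ 'n.
    (\<integral>\<^sup>+y. ennreal (min 1 ((norm (x - y))\<^sup>2) / norm (x - y) powr (real CARD('n) + 2 * s)) \<partial>lebesgue) \<le> ennreal C"
proof -
  define n where "n = real CARD('n)"
  define \<beta> where "\<beta> = n + 2 * s"
  define \<omega> where "\<omega> = unit_ball_vol n"
  have n: "n > 0" by (simp add: n_def)
  have \<beta>: "\<beta> > 0" using n s by (simp add: \<beta>_def)
  have \<omega>: "\<omega> > 0" unfolding \<omega>_def using n by simp
  \<comment> \<open>\<open>A k\<close> is the kernel bound for 2^k \<le> |x - y| < 2^(k+1) times the
    measure of the ball of radius 2^(k+1). \<open>B k\<close> treats 1/2^(k+1) < |x - y| \<le> 1/2^k
    in the same way; its ball has twice the outer radius, so that the open ball contains the closed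
    outer sphere.\<close>
  define A where "A = (\<lambda>k::nat. (2 ^ k) powr (- \<beta>) * (\<omega> * (2 ^ (k + 1)) powr n))"
  define B where "B = (\<lambda>k::nat. ((1 / 2 ^ k)\<^sup>2 * (2 ^ (k + 1)) powr \<beta>) * (\<omega> * (2 * (1 / 2 ^ k)) powr n))"
  have A: "A k = \<omega> * 2 powr n * (2 powr (- 2 * s)) ^ k" for k
  proof -
    have "(2 ^ k :: real) = 2 powr real k" "(2 ^ (k + 1) :: real) = 2 powr (real k + 1)"
      by (simp_all add: powr_realpow[symmetric] powr_add)
    then have "A k = \<omega> * (2 powr (- \<beta> * k) * 2 powr (n * (k + 1)))"
      unfolding A_def by (simp add: powr_powr mult_ac add.commute)
    also have "2 powr (- \<beta> * k) * 2 powr (n * (k + 1)) = 2 powr n * 2 powr (- 2 * s * k)"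
      by (simp add: powr_add[symmetric] \<beta>_def algebra_simps)
    also have "2 powr (- 2 * s * k) = (2 powr (- 2 * s)) powr real k" by (simp only: powr_powr)
    also have "\<dots> = (2 powr (- 2 * s)) ^ k" by (rule powr_realpow) simp
    finally show ?thesis by (simp only: mult.assoc)
  qed
  have B: "B k = \<omega> * 2 powr (n + \<beta>) * (2 powr (2 * s - 2)) ^ k" for k
  proof -
    have "1 / 2 ^ k = (2::real) powr (- real k)"
      by (simp add: powr_minus powr_realpow divide_inverse)
    moreover have "(2 ^ (k + 1) :: real) = 2 powr (real k + 1)"
      by (simp add: powr_realpow[symmetric] powr_add)
    moreover have "2 * 2 powr (- real k) = (2::real) powr (1 - real k)"
      by (simp add: powr_diff powr_minus divide_inverse)
    moreover have "(2 powr (- real k))\<^sup>2 = (2::real) powr (- 2 * k)"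
      by (simp add: power2_eq_square powr_add[symmetric])
    ultimately have "B k = \<omega> * (2 powr (- 2 * k) * 2 powr ((k + 1) * \<beta>) * 2 powr ((1 - real k) * n))"
      unfolding B_def by (simp add: powr_powr mult_ac add.commute)
    also have "2 powr (- 2 * k) * 2 powr ((k + 1) * \<beta>) * 2 powr ((1 - real k) * n)
        = 2 powr (n + \<beta>) * 2 powr ((2 * s - 2) * k)"
      by (simp add: powr_add[symmetric] \<beta>_def algebra_simps)
    also have "2 powr ((2 * s - 2) * k) = (2 powr (2 * s - 2)) powr real k" by (simp only: powr_powr)
    also have "\<dots> = (2 powr (2 * s - 2)) ^ k" by (rule powr_realpow) simp
    finally show ?thesis by (simp only: mult.assoc)
  qed
  have sumA: "summable A" unfolding A[abs_def]
    using s by (intro summable_mult summable_geometric) (auto simp: powr_less_one)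
  have sumB: "summable B" unfolding B[abs_def]
    using s by (intro summable_mult summable_geometric) (auto simp: powr_less_one)
  have A0: "A k \<ge> 0" and B0: "B k \<ge> 0" for k using \<omega> by (auto simp: A_def B_def)
  show ?thesis
  proof
    fix x :: "real ^ 'n"
    have ball: "emeasure lebesgue (ball x r) = ennreal (\<omega> * r powr n)" if "r > 0" for r
      using that by (simp add: emeasure_ball \<omega>_def n_def powr_realpow)
    \<comment> \<open>\<open>?a k\<close> and \<open>?b k\<close> dominate the kernel on the annuli of radii about \<open>2 ^ k\<close> and \<open>1 / 2 ^ k\<close>.\<close>
    let ?a = "\<lambda>k y. ennreal ((2 ^ k) powr (- \<beta>)) * indicator (ball x (2 ^ (k + 1))) y"
    let ?b = "\<lambda>k y. ennreal ((1 / 2 ^ k)\<^sup>2 * (2 ^ (k + 1)) powr \<beta>) * indicator (ball x (2 * (1 / 2 ^ k))) y"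
    have "(\<integral>\<^sup>+y. ennreal (min 1 ((norm (x - y))\<^sup>2) / norm (x - y) powr \<beta>) \<partial>lebesgue)
       \<le> (\<integral>\<^sup>+y. (\<Sum>k. ?a k y) + (\<Sum>k. ?b k y) \<partial>lebesgue)"
    proof (rule nn_integral_mono)
      fix y
      define t where "t = norm (x - y)"
      have sum_ge: "f k \<le> (\<Sum>k. f k)" for f :: "nat \<Rightarrow> ennreal" and k
        using sum_le_suminf[of f "{k}"] by (simp add: summableI)
      consider "t = 0" | "1 \<le> t" | "0 < t" "t < 1" unfolding t_def by fastforce
      then show "ennreal (min 1 ((norm (x - y))\<^sup>2) / norm (x - y) powr \<beta>) \<le> (\<Sum>k. ?a k y) + (\<Sum>k. ?b k y)"
      proof cases
        case 1
        then show ?thesis by (simp add: t_def)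
      next
        case 2
        then obtain k where k: "2 ^ k \<le> t" "t < 2 ^ (k + 1)" by (rule dyadic_bracket)
        have "min 1 (t\<^sup>2) / t powr \<beta> \<le> 1 / (2 ^ k) powr \<beta>"
          using 2 k \<beta> by (intro frac_le powr_mono2) auto
        then have "ennreal (min 1 (t\<^sup>2) / t powr \<beta>) \<le> ?a k y"
          using k by (auto simp: powr_minus divide_inverse t_def dist_norm indicator_def intro!: ennreal_leI)
        also have "\<dots> \<le> (\<Sum>k. ?a k y)" by (rule sum_ge)
        also have "\<dots> \<le> (\<Sum>k. ?a k y) + (\<Sum>k. ?b k y)" by simp
        finally show ?thesis by (simp add: t_def)
      next
        case 3
        then have "1 \<le> 1 / t" by simp
        then obtain k where k: "2 ^ k \<le> 1 / t" "1 / t < 2 ^ (k + 1)" by (rule dyadic_bracket)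
        have t1: "t \<le> 1 / 2 ^ k" "1 / 2 ^ (k + 1) < t"
          using k 3 by (auto simp: field_simps)
        have "min 1 (t\<^sup>2) / t powr \<beta> \<le> (1 / 2 ^ k)\<^sup>2 / (1 / 2 ^ (k + 1)) powr \<beta>"
          using 3 t1 \<beta> by (intro frac_le powr_mono2 min.coboundedI2 power_mono) auto
        also have "\<dots> = (1 / 2 ^ k)\<^sup>2 * (2 ^ (k + 1)) powr \<beta>"
          by (simp add: powr_divide)
        finally have "min 1 (t\<^sup>2) / t powr \<beta> \<le> (1 / 2 ^ k)\<^sup>2 * (2 ^ (k + 1)) powr \<beta>" .
        moreover have "y \<in> ball x (2 * (1 / 2 ^ k))"
          using t1 3 by (simp add: t_def dist_norm)
        ultimately have "ennreal (min 1 (t\<^sup>2) / t powr \<beta>) \<le> ?b k y"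
          by (auto intro!: ennreal_leI)
        also have "\<dots> \<le> (\<Sum>k. ?b k y)" by (rule sum_ge)
        also have "\<dots> \<le> (\<Sum>k. ?a k y) + (\<Sum>k. ?b k y)" by simp
        finally show ?thesis by (simp add: t_def)
      qed
    qed
    also have "\<dots> = (\<Sum>k. \<integral>\<^sup>+y. ?a k y \<partial>lebesgue) + (\<Sum>k. \<integral>\<^sup>+y. ?b k y \<partial>lebesgue)"
    proof -
      have m: "?a k \<in> borel_measurable lebesgue" "?b k \<in> borel_measurable lebesgue" for k
        by (intro borel_measurable_times_ennreal borel_measurable_indicator borel_measurable_const; simp)+
      have "(\<integral>\<^sup>+y. (\<Sum>k. ?a k y) + (\<Sum>k. ?b k y) \<partial>lebesgue)
          = (\<integral>\<^sup>+y. (\<Sum>k. ?a k y) \<partial>lebesgue) + (\<integral>\<^sup>+y. (\<Sum>k. ?b k y) \<partial>lebesgue)"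
        by (intro nn_integral_add borel_measurable_suminf_order m)
      also have "(\<integral>\<^sup>+y. (\<Sum>k. ?a k y) \<partial>lebesgue) = (\<Sum>k. \<integral>\<^sup>+y. ?a k y \<partial>lebesgue)"
        by (intro nn_integral_suminf m)
      also have "(\<integral>\<^sup>+y. (\<Sum>k. ?b k y) \<partial>lebesgue) = (\<Sum>k. \<integral>\<^sup>+y. ?b k y \<partial>lebesgue)"
        by (intro nn_integral_suminf m)
      finally show ?thesis .
    qed
    also have "\<dots> = (\<Sum>k. ennreal (A k)) + (\<Sum>k. ennreal (B k))"
    proof (intro arg_cong2[where f="(+)"] suminf_cong)
      fix k :: nat
      have "(\<integral>\<^sup>+y. ?a k y \<partial>lebesgue) = ennreal ((2 ^ k) powr (- \<beta>)) * emeasure lebesgue (ball x (2 ^ (k + 1)))"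
        by (rule nn_integral_cmult_indicator) simp
      also have "\<dots> = ennreal ((2 ^ k) powr (- \<beta>)) * ennreal (\<omega> * (2 ^ (k + 1)) powr n)"
        by (subst ball) simp_all
      also have "\<dots> = ennreal (A k)"
        unfolding A_def using \<omega> by (intro ennreal_mult[symmetric]) simp_all
      finally show "(\<integral>\<^sup>+y. ?a k y \<partial>lebesgue) = ennreal (A k)" .
      have "(\<integral>\<^sup>+y. ?b k y \<partial>lebesgue)
          = ennreal ((1 / 2 ^ k)\<^sup>2 * (2 ^ (k + 1)) powr \<beta>) * emeasure lebesgue (ball x (2 * (1 / 2 ^ k)))"
        by (rule nn_integral_cmult_indicator) simp
      also have "\<dots> = ennreal ((1 / 2 ^ k)\<^sup>2 * (2 ^ (k + 1)) powr \<beta>) * ennreal (\<omega> * (2 * (1 / 2 ^ k)) powr n)"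
        by (subst ball) simp_all
      also have "\<dots> = ennreal (B k)"
        unfolding B_def using \<omega> by (intro ennreal_mult[symmetric]) simp_all
      finally show "(\<integral>\<^sup>+y. ?b k y \<partial>lebesgue) = ennreal (B k)" .
    qed
    also have "(\<Sum>k. ennreal (A k)) + (\<Sum>k. ennreal (B k)) = ennreal (suminf A + suminf B)"
      by (simp only: suminf_ennreal2[OF A0 sumA] suminf_ennreal2[OF B0 sumB]
          ennreal_plus[OF suminf_nonneg[OF sumA A0] suminf_nonneg[OF sumB B0]])
    finally show "(\<integral>\<^sup>+y. ennreal (min 1 ((norm (x - y))\<^sup>2) / norm (x - y) powr (real CARD('n) + 2 * s)) \<partial>lebesgue)
       \<le> ennreal (suminf A + suminf B)"
      by (simp add: \<beta>_def n_def)
  qed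
qed

text \<open>The tent is 1-Lipschitz with values in [0,1], so its squared increments are at most min
  1 |x - y|^2. The region of integration is covered by the pairs with first point in \<Omega> and
  those with second point in \<Omega>; each family contributes at most C times the measure of
  \<Omega>.\<close>

lemma tent_in_X0_space:
  fixes x0 :: "real ^ 'n"
  assumes s: "0 < s" "s < 1" and \<Omega> [measurable]: "\<Omega> \<in> sets lebesgue" and bd: "bounded \<Omega>"
    and r: "0 < r" "r \<le> 1" and ball: "ball x0 r \<subseteq> \<Omega>"
  shows "(\<lambda>x. max 0 (r - norm (x - x0))) \<in> X0_space s \<Omega>"
proof -
  define u where "u = (\<lambda>x. max 0 (r - norm (x - x0)))"
  define \<beta> where "\<beta> = real CARD('n) + 2 * s"
  define k where "k = (\<lambda>x y :: real ^ 'n. min 1 ((norm (x - y))\<^sup>2) / norm (x - y) powr \<beta>)"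
  have um [measurable]: "u \<in> borel_measurable lebesgue" unfolding u_def by measurable
  have um' [measurable]: "u \<in> borel_measurable (lebesgue_on \<Omega>)"
    by (rule measurable_restrict_space1) (rule um)
  have km [measurable]: "(\<lambda>z. k (fst z) (snd z)) \<in> borel_measurable (lebesgue \<Otimes>\<^sub>M lebesgue)"
    unfolding k_def by measurable
  have fin: "emeasure lebesgue \<Omega> < \<infinity>"
    using bounded_set_imp_lmeasurable[OF bd \<Omega>] by (simp add: fmeasurable_def)
  obtain C where C: "\<And>x. (\<integral>\<^sup>+y. ennreal (k x y) \<partial>lebesgue) \<le> ennreal C"
    using nn_integral_truncated_kernel_bounded[OF s, where 'n='n] unfolding k_def \<beta>_def by blast
  have u01: "0 \<le> u x" "u x \<le> 1" for x
    using r norm_ge_zero[of "x - x0"] by (auto simp: u_def simp del: norm_ge_zero)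
  have lip: "(u x - u y)\<^sup>2 \<le> min 1 ((norm (x - y))\<^sup>2)" for x y
  proof -
    have "\<bar>u x - u y\<bar> \<le> \<bar>norm (x - x0) - norm (y - x0)\<bar>" by (auto simp: u_def)
    also have "\<dots> \<le> norm (x - y)"
      using norm_triangle_ineq3[of "x - x0" "y - x0"] by simp
    finally have "(u x - u y)\<^sup>2 \<le> (norm (x - y))\<^sup>2"
      using abs_le_square_iff[of "u x - u y" "norm (x - y)"] by simp
    moreover have "(u x - u y)\<^sup>2 \<le> 1"
      using u01[of x] u01[of y] by (simp add: abs_square_le_1 abs_le_iff)
    ultimately show ?thesis by simp
  qed
  have Qm [measurable]: "Q_region \<Omega> \<in> sets (lebesgue \<Otimes>\<^sub>M lebesgue)"
  proof -
    have "- \<Omega> \<in> sets lebesgue" using sets.compl_sets[OF \<Omega>] by (simp add: Compl_eq_Diff_UNIV)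
    then have "(- \<Omega>) \<times> (- \<Omega>) \<in> sets (lebesgue \<Otimes>\<^sub>M lebesgue)" by (intro pair_measureI)
    from sets.compl_sets[OF this] show ?thesis
      by (simp add: Q_region_def Compl_eq_Diff_UNIV space_pair_measure)
  qed
  let ?M = "lebesgue \<Otimes>\<^sub>M lebesgue"
  have "(\<integral>\<^sup>+z. ennreal (indicator (Q_region \<Omega>) z * ((u (fst z) - u (snd z))\<^sup>2 / norm (fst z - snd z) powr \<beta>)) \<partial>?M)
    \<le> (\<integral>\<^sup>+z. indicator \<Omega> (fst z) * ennreal (k (fst z) (snd z)) + indicator \<Omega> (snd z) * ennreal (k (fst z) (snd z)) \<partial>?M)"
  proof (rule nn_integral_mono)
    fix z
    have "(u (fst z) - u (snd z))\<^sup>2 / norm (fst z - snd z) powr \<beta> \<le> k (fst z) (snd z)"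
      unfolding k_def using lip by (intro divide_right_mono) auto
    then have "ennreal ((u (fst z) - u (snd z))\<^sup>2 / norm (fst z - snd z) powr \<beta>) \<le> ennreal (k (fst z) (snd z))"
      by (rule ennreal_leI)
    then show "ennreal (indicator (Q_region \<Omega>) z * ((u (fst z) - u (snd z))\<^sup>2 / norm (fst z - snd z) powr \<beta>))
      \<le> indicator \<Omega> (fst z) * ennreal (k (fst z) (snd z)) + indicator \<Omega> (snd z) * ennreal (k (fst z) (snd z))"
      by (cases z) (auto simp: Q_region_def indicator_def intro: order_trans)
  qed
  also have "\<dots> = (\<integral>\<^sup>+z. indicator \<Omega> (fst z) * ennreal (k (fst z) (snd z)) \<partial>?M)
      + (\<integral>\<^sup>+z. indicator \<Omega> (snd z) * ennreal (k (fst z) (snd z)) \<partial>?M)"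
    by (rule nn_integral_add) measurable
  also have "(\<integral>\<^sup>+z. indicator \<Omega> (fst z) * ennreal (k (fst z) (snd z)) \<partial>?M)
      = (\<integral>\<^sup>+x. \<integral>\<^sup>+y. indicator \<Omega> x * ennreal (k x y) \<partial>lebesgue \<partial>lebesgue)"
    by (subst lebesgue.nn_integral_fst[symmetric]) (auto)
  also have "\<dots> = (\<integral>\<^sup>+x. indicator \<Omega> x * \<integral>\<^sup>+y. ennreal (k x y) \<partial>lebesgue \<partial>lebesgue)"
    by (intro nn_integral_cong nn_integral_cmult) (simp add: k_def)
  also have "(\<integral>\<^sup>+z. indicator \<Omega> (snd z) * ennreal (k (fst z) (snd z)) \<partial>?M)
      = (\<integral>\<^sup>+y. \<integral>\<^sup>+x. indicator \<Omega> y * ennreal (k x y) \<partial>lebesgue \<partial>lebesgue)"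
    by (subst lebesgue2.nn_integral_snd[symmetric]) (auto)
  also have "\<dots> = (\<integral>\<^sup>+y. indicator \<Omega> y * \<integral>\<^sup>+x. ennreal (k y x) \<partial>lebesgue \<partial>lebesgue)"
    by (intro nn_integral_cong, subst nn_integral_cmult[symmetric])
      (auto simp: k_def norm_minus_commute)
  also have "(\<integral>\<^sup>+x. indicator \<Omega> x * \<integral>\<^sup>+y. ennreal (k x y) \<partial>lebesgue \<partial>lebesgue)
      \<le> (\<integral>\<^sup>+x. ennreal C * indicator \<Omega> x \<partial>lebesgue)"
    using C by (intro nn_integral_mono) (auto simp: indicator_def)
  also have "(\<integral>\<^sup>+x. ennreal C * indicator \<Omega> x \<partial>lebesgue) = ennreal C * emeasure lebesgue \<Omega>"
    by (simp add: nn_integral_cmult_indicator)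
  finally have "(\<integral>\<^sup>+z. ennreal (indicator (Q_region \<Omega>) z * ((u (fst z) - u (snd z))\<^sup>2 / norm (fst z - snd z) powr \<beta>)) \<partial>?M)
     \<le> ennreal C * emeasure lebesgue \<Omega> + ennreal C * emeasure lebesgue \<Omega>"
    by (simp add: add_mono)
  also have "\<dots> < \<infinity>" using fin by (simp add: ennreal_mult_less_top)
  finally have "integrable ?M (\<lambda>z. indicator (Q_region \<Omega>) z * ((u (fst z) - u (snd z))\<^sup>2 / norm (fst z - snd z) powr \<beta>))"
    by (intro integrableI_nonneg) auto
  moreover have "integrable (lebesgue_on \<Omega>) (\<lambda>x. (u x)\<^sup>2)"
  proof (rule integrableI_bounded_set[where A=\<Omega> and B=1])
    show "emeasure (lebesgue_on \<Omega>) \<Omega> < \<infinity>"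
      using fin by (simp add: emeasure_restrict_space)
    show "AE x in lebesgue_on \<Omega>. x \<in> \<Omega> \<longrightarrow> norm ((u x)\<^sup>2) \<le> 1"
      using u01 by (intro AE_I2) (auto intro: power_le_one)
  qed (auto simp: sets_restrict_space)
  moreover have "AE x in lebesgue. x \<notin> \<Omega> \<longrightarrow> u x = 0"
    using ball by (intro AE_I2) (force simp: u_def dist_norm norm_minus_commute subset_iff not_less)
  ultimately have "u \<in> X0_space s \<Omega>"
    by (simp add: X0_space_def set_integrable_def case_prod_unfold \<beta>_def)
  then show ?thesis by (simp add: u_def)
qed

text \<open>A real infimum over an empty set carries no information, so lower bounds for
  \<open>S_const\<close> and \<open>lambda0_bar\<close> need a witness. It is a tent inside
  \<Omega>, of radius at most 1 to keep its values in [0,1].\<close>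

lemma X0_nonzero_nonempty:
  fixes \<Omega> :: "(real ^ 'n) set"
  assumes s: "0 < s" "s < 1" and \<Omega>: "open \<Omega>" "bounded \<Omega>" "\<Omega> \<noteq> {}"
  shows "X0_nonzero s \<Omega> \<noteq> {}"
proof -
  obtain x0 where "x0 \<in> \<Omega>" using \<Omega> by auto
  then obtain r' where r': "r' > 0" "ball x0 r' \<subseteq> \<Omega>" using \<Omega> open_contains_ball by blast
  define r where "r = min r' 1"
  have r: "0 < r" "r \<le> 1" "ball x0 r \<subseteq> \<Omega>"
    using r' by (auto simp: r_def)
  let ?u = "\<lambda>x. max 0 (r - norm (x - x0))"
  have "?u \<in> X0_space s \<Omega>"
    using r \<Omega> by (intro tent_in_X0_space s) auto
  moreover have "\<not> (AE x in lebesgue. ?u x = 0)"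
  proof
    assume "AE x in lebesgue. ?u x = 0"
    then have "AE x in lebesgue. x \<notin> ball x0 r"
      by eventually_elim (auto simp: dist_norm norm_minus_commute max_def split: if_splits)
    then have "ball x0 r \<in> null_sets lebesgue"
      by (subst AE_iff_null_sets) auto
    then have "emeasure lebesgue (ball x0 r) = 0" by auto
    then show False using r unit_ball_vol_pos[of "real CARD('n)"] by (simp add: emeasure_ball)
  qed
  ultimately show ?thesis by (auto simp: X0_nonzero_def)
qed

section \<open>Positivity of the norms, the Sobolev constant and a Poincare inequality\<close>

lemma AE_zero_if_zero_on:
  assumes \<Omega> [measurable]: "\<Omega> \<in> sets lebesgue" and u: "u \<in> X0_space s \<Omega>"
    and 0: "AE x in lebesgue_on \<Omega>. u x = 0"
  shows "AE x in lebesgue. u x = 0"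
proof -
  have "AE x in lebesgue. x \<in> \<Omega> \<longrightarrow> u x = 0"
    using 0 by (subst (asm) AE_restrict_space_iff) auto
  moreover have "AE x in lebesgue. x \<notin> \<Omega> \<longrightarrow> u x = 0"
    using u by (simp add: X0_space_def)
  ultimately show ?thesis by eventually_elim auto
qed

text \<open>A vanishing critical integral would force u = 0 almost everywhere in \<Omega>, hence
  everywhere up to a null set by the exterior condition. Positivity of the energy norm then follows
  from the Sobolev inequality.\<close>

lemma X0_nonzero_pos:
  fixes \<Omega> :: "(real ^ 'n) set"
  assumes s: "0 < s" and N: "real CARD('n) > 4 * s"
    and \<Omega> [measurable]: "\<Omega> \<in> sets lebesgue" and bd: "bounded \<Omega>"
    and u: "u \<in> X0_nonzero s \<Omega>"
  shows "0 < (LINT x|lebesgue_on \<Omega>. \<bar>u x\<bar> powr crit_exp (real CARD('n)) s)"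
    and "0 < Lq_norm \<Omega> (crit_exp (real CARD('n)) s) u"
    and "0 < X0_norm s \<Omega> u"
proof -
  have uX: "u \<in> X0_space s \<Omega>" and nz: "\<not> (AE x in lebesgue. u x = 0)"
    using u by (auto simp: X0_nonzero_def)
  define q where "q = crit_exp (real CARD('n)) s"
  define J where "J = (LINT x|lebesgue_on \<Omega>. \<bar>u x\<bar> powr q)"
  have "J \<noteq> 0"
  proof
    assume "J = 0"
    then have "AE x in lebesgue_on \<Omega>. \<bar>u x\<bar> powr q = 0"
      unfolding J_def using sobolev_integrable[OF s N \<Omega> bd uX]
      by (subst (asm) integral_nonneg_eq_0_iff_AE) (auto simp: q_def)
    then have "AE x in lebesgue_on \<Omega>. u x = 0" by simp
    then show False using AE_zero_if_zero_on[OF \<Omega> uX] nz by simp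
  qed
  moreover have "J \<ge> 0" by (simp add: J_def)
  ultimately have J: "J > 0" by simp
  then show "0 < (LINT x|lebesgue_on \<Omega>. \<bar>u x\<bar> powr crit_exp (real CARD('n)) s)"
    by (simp add: J_def q_def)
  show L: "0 < Lq_norm \<Omega> (crit_exp (real CARD('n)) s) u"
    using J by (simp add: Lq_norm_def J_def q_def)
  have "X0_norm s \<Omega> u \<noteq> 0"
  proof
    assume "X0_norm s \<Omega> u = 0"
    then have "(Lq_norm \<Omega> (crit_exp (real CARD('n)) s) u)\<^sup>2 \<le> 0"
      using sobolev_inequality[OF s N \<Omega> bd uX] by simp
    then show False using L by simp
  qed
  then show "0 < X0_norm s \<Omega> u" using X0_norm_nonneg[of s \<Omega> u] by linarith
qed

lemma S_const_pos:
  fixes \<Omega> :: "(real ^ 'n) set"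
  assumes s: "0 < s" "s < 1" and N: "real CARD('n) > 4 * s"
    and \<Omega>: "open \<Omega>" "bounded \<Omega>" "\<Omega> \<noteq> {}"
  shows "0 < S_const s \<Omega>"
proof -
  have \<Omega>m: "\<Omega> \<in> sets lebesgue" using \<Omega> by auto
  have c: "sobolev_factor TYPE('n) s > 0" by (rule sobolev_factor_pos)
  have "1 / sobolev_factor TYPE('n) s \<le> S_const s \<Omega>"
    unfolding S_const_def
  proof (rule cINF_greatest)
    show "X0_nonzero s \<Omega> \<noteq> {}" by (rule X0_nonzero_nonempty) fact+
    fix u assume u: "u \<in> X0_nonzero s \<Omega>"
    then have uX: "u \<in> X0_space s \<Omega>" by (simp add: X0_nonzero_def)
    show "1 / sobolev_factor TYPE('n) s
      \<le> (X0_norm s \<Omega> u)\<^sup>2 / (Lq_norm \<Omega> (crit_exp (real CARD('n)) s) u)\<^sup>2"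
      using sobolev_inequality[OF s(1) N \<Omega>m \<Omega>(2) uX] X0_nonzero_pos(2)[OF s(1) N \<Omega>m \<Omega>(2) u] c
      by (simp add: field_simps)
  qed
  moreover have "0 < 1 / sobolev_factor TYPE('n) s" using c by simp
  ultimately show ?thesis by linarith
qed

text \<open>This is the quotient defining \<open>S_const\<close>, evaluated at \<open>u\<close> and
  raised to the power q/2. The threshold on a and b is expressed through this best constant, so the
  cruder \<open>sobolev_factor\<close> would not do here.\<close>

lemma critical_integral_le:
  fixes \<Omega> :: "(real ^ 'n) set"
  assumes s: "0 < s" "s < 1" and N: "real CARD('n) > 4 * s"
    and \<Omega>: "open \<Omega>" "bounded \<Omega>" "\<Omega> \<noteq> {}" and u: "u \<in> X0_nonzero s \<Omega>"
  defines "q \<equiv> crit_exp (real CARD('n)) s"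
  shows "(LINT x|lebesgue_on \<Omega>. \<bar>u x\<bar> powr q) \<le> S_const s \<Omega> powr (- (q / 2)) * X0_norm s \<Omega> u powr q"
proof -
  have \<Omega>m: "\<Omega> \<in> sets lebesgue" using \<Omega> by auto
  have q: "q > 2" unfolding q_def using crit_exp_bounds[OF s(1) N] by simp
  define J where "J = (LINT x|lebesgue_on \<Omega>. \<bar>u x\<bar> powr q)"
  note pos = X0_nonzero_pos[OF s(1) N \<Omega>m \<Omega>(2) u, folded q_def]
  have J: "J > 0" using pos(1) by (simp add: J_def)
  have S: "S_const s \<Omega> > 0" by (rule S_const_pos) fact+
  have "S_const s \<Omega> \<le> (X0_norm s \<Omega> u)\<^sup>2 / (Lq_norm \<Omega> q u)\<^sup>2"
    unfolding S_const_def q_def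
    by (rule cINF_lower[OF _ u]) (auto intro!: bdd_belowI[of _ 0])
  then have "(Lq_norm \<Omega> q u)\<^sup>2 \<le> (X0_norm s \<Omega> u)\<^sup>2 / S_const s \<Omega>"
    using S pos(2) by (simp add: field_simps)
  then have "((Lq_norm \<Omega> q u)\<^sup>2) powr (q / 2) \<le> ((X0_norm s \<Omega> u)\<^sup>2 / S_const s \<Omega>) powr (q / 2)"
    using q by (intro powr_mono2) auto
  also have "((Lq_norm \<Omega> q u)\<^sup>2) powr (q / 2) = J"
    using pos(2) q J by (simp add: power2_powr powr_powr Lq_norm_def flip: J_def)
  also have "((X0_norm s \<Omega> u)\<^sup>2 / S_const s \<Omega>) powr (q / 2) = ((X0_norm s \<Omega> u)\<^sup>2) powr (q / 2) / S_const s \<Omega> powr (q / 2)"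
    by (rule powr_divide)
  also have "((X0_norm s \<Omega> u)\<^sup>2) powr (q / 2) = X0_norm s \<Omega> u powr q"
    using pos(3) q by (simp add: power2_powr)
  finally show ?thesis by (simp add: J_def powr_minus field_simps)
qed

text \<open>The values are split at the level t = norm of \<open>u\<close>: below it u^2 \<le> t^2,
  above it u^2 \<le> t^(2 - q) |u|^q. This choice of level makes both parts multiples of t^2 after
  integration.\<close>

lemma poincare_inequality:
  fixes \<Omega> :: "(real ^ 'n) set"
  assumes s: "0 < s" "s < 1" and N: "real CARD('n) > 4 * s"
    and \<Omega>: "open \<Omega>" "bounded \<Omega>" "\<Omega> \<noteq> {}" and u: "u \<in> X0_nonzero s \<Omega>"
  shows "(LINT x|lebesgue_on \<Omega>. (u x)\<^sup>2)
    \<le> (measure lebesgue \<Omega> + S_const s \<Omega> powr (- (crit_exp (real CARD('n)) s / 2))) * (X0_norm s \<Omega> u)\<^sup>2"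
proof -
  have \<Omega>m [measurable]: "\<Omega> \<in> sets lebesgue" using \<Omega> by auto
  define q where "q = crit_exp (real CARD('n)) s"
  have q: "q > 2" unfolding q_def using crit_exp_bounds[OF s(1) N] by simp
  define t where "t = X0_norm s \<Omega> u"
  have t: "t > 0" unfolding t_def using X0_nonzero_pos(3)[OF s(1) N \<Omega>m \<Omega>(2) u] .
  have uX: "u \<in> X0_space s \<Omega>" using u by (simp add: X0_nonzero_def)
  have fin: "emeasure lebesgue \<Omega> < \<infinity>"
    using bounded_set_imp_lmeasurable[OF \<Omega>(2) \<Omega>m] by (simp add: fmeasurable_def)
  have intq: "integrable (lebesgue_on \<Omega>) (\<lambda>x. \<bar>u x\<bar> powr q)"
    unfolding q_def by (rule sobolev_integrable[OF s(1) N \<Omega>m \<Omega>(2) uX])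
  have fm: "finite_measure (lebesgue_on \<Omega>)"
    using fin by (intro finite_measureI) (simp add: emeasure_restrict_space)
  have int1: "integrable (lebesgue_on \<Omega>) (\<lambda>x. t\<^sup>2)"
    by (rule finite_measure.integrable_const[OF fm])
  have "(LINT x|lebesgue_on \<Omega>. (u x)\<^sup>2) \<le> (LINT x|lebesgue_on \<Omega>. t\<^sup>2 + t powr (2 - q) * \<bar>u x\<bar> powr q)"
  proof (rule integral_mono)
    show "integrable (lebesgue_on \<Omega>) (\<lambda>x. (u x)\<^sup>2)" using uX by (simp add: X0_space_def)
    show "integrable (lebesgue_on \<Omega>) (\<lambda>x. t\<^sup>2 + t powr (2 - q) * \<bar>u x\<bar> powr q)"
      using int1 intq by auto
    fix x
    show "(u x)\<^sup>2 \<le> t\<^sup>2 + t powr (2 - q) * \<bar>u x\<bar> powr q"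
    proof (cases "\<bar>u x\<bar> \<le> t")
      case True
      then have "(u x)\<^sup>2 \<le> t\<^sup>2" using t by (metis abs_le_square_iff abs_of_pos)
      then show ?thesis by (simp add: add_increasing2)
    next
      case False
      then have "\<bar>u x\<bar> powr (2 - q) \<le> t powr (2 - q)"
        using t q by (intro powr_mono2') auto
      then have "\<bar>u x\<bar> powr (2 - q) * \<bar>u x\<bar> powr q \<le> t powr (2 - q) * \<bar>u x\<bar> powr q"
        by (intro mult_right_mono) auto
      moreover have "\<bar>u x\<bar> powr (2 - q) * \<bar>u x\<bar> powr q = (u x)\<^sup>2"
        using False t by (simp add: powr_add[symmetric] powr_numeral)
      moreover have "0 \<le> t\<^sup>2" by simp
      ultimately show ?thesis by linarith
    qed
  qed
  also have "\<dots> = t\<^sup>2 * measure lebesgue \<Omega> + t powr (2 - q) * (LINT x|lebesgue_on \<Omega>. \<bar>u x\<bar> powr q)"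
    using int1 intq by (simp add: measure_restrict_space)
  also have "\<dots> \<le> t\<^sup>2 * measure lebesgue \<Omega> + t powr (2 - q) * (S_const s \<Omega> powr (- (q / 2)) * t powr q)"
    using critical_integral_le[OF s N \<Omega> u] by (intro add_left_mono mult_left_mono) (auto simp: q_def t_def)
  also have "t powr (2 - q) * (S_const s \<Omega> powr (- (q / 2)) * t powr q) = S_const s \<Omega> powr (- (q / 2)) * t\<^sup>2"
  proof -
    have "t powr (2 - q) * t powr q = t\<^sup>2" using t by (simp add: powr_add[symmetric] powr_numeral)
    then show ?thesis by (simp add: mult_ac)
  qed
  finally show ?thesis by (simp add: t_def q_def algebra_simps)
qed

subsection \<open>Superposition operators\<close>

text \<open>Rounding \<open>v\<close> down to the grid of mesh 1/(n+1) leaves countably many values,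
  so each approximant is measurable by pasting; continuity in the second argument gives the
  limit.\<close>

lemma borel_measurable_caratheodory:
  fixes g :: "'a \<Rightarrow> real \<Rightarrow> real"
  assumes m: "\<And>t. (\<lambda>x. g x t) \<in> borel_measurable M"
    and c: "\<And>x. x \<in> space M \<Longrightarrow> continuous_on UNIV (g x)"
    and v [measurable]: "v \<in> borel_measurable M"
  shows "(\<lambda>x. g x (v x)) \<in> borel_measurable M"
proof (rule borel_measurable_LIMSEQ_real)
  fix n :: nat
  have "(\<lambda>x. \<lfloor>v x * real (Suc n)\<rfloor>) \<in> measurable M (count_space UNIV)" by measurable
  then show "(\<lambda>x. g x (of_int \<lfloor>v x * real (Suc n)\<rfloor> / real (Suc n))) \<in> borel_measurable M"
    by (rule measurable_compose_countable'[OF m]) simp_all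
next
  fix x assume "x \<in> space M"
  then have "isCont (g x) (v x)" using c continuous_on_eq_continuous_at by blast
  moreover have "(\<lambda>n. of_int \<lfloor>v x * real (Suc n)\<rfloor> / real (Suc n)) \<longlonglongrightarrow> v x"
  proof (rule real_tendsto_sandwich)
    show "\<forall>\<^sub>F n in sequentially. v x - 1 / real (Suc n) \<le> of_int \<lfloor>v x * real (Suc n)\<rfloor> / real (Suc n)"
    proof (intro always_eventually allI)
      fix n
      have "v x * real (Suc n) - 1 \<le> of_int \<lfloor>v x * real (Suc n)\<rfloor>" by linarith
      then have "(v x * real (Suc n) - 1) / real (Suc n) \<le> of_int \<lfloor>v x * real (Suc n)\<rfloor> / real (Suc n)"
        by (rule divide_right_mono) simp
      then show "v x - 1 / real (Suc n) \<le> of_int \<lfloor>v x * real (Suc n)\<rfloor> / real (Suc n)"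
        by (simp add: diff_divide_distrib)
    qed
    show "\<forall>\<^sub>F n in sequentially. of_int \<lfloor>v x * real (Suc n)\<rfloor> / real (Suc n) \<le> v x"
      by (intro always_eventually allI) (subst pos_divide_le_eq, simp, linarith)
    have "(\<lambda>n. 1 / real (Suc n)) \<longlonglongrightarrow> 0"
      using LIMSEQ_inverse_real_of_nat by (simp add: inverse_eq_divide)
    from tendsto_diff[OF tendsto_const this] show "(\<lambda>n. v x - 1 / real (Suc n)) \<longlonglongrightarrow> v x" by simp
  qed simp
  ultimately show "(\<lambda>n. g x (of_int \<lfloor>v x * real (Suc n)\<rfloor> / real (Suc n))) \<longlonglongrightarrow> g x (v x)"
    by (rule isCont_tendsto_compose)
qed

text \<open>Joint measurability of \<open>g\<close> is the Caratheodory lemma applied on the product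
  space with the second coordinate as inner function. The oriented integral is then written,
  according to the sign of its endpoint, as a parameter integral with a measurable
  integrand.\<close>

lemma borel_measurable_primitive:
  assumes m: "\<And>t. (\<lambda>x. g x t) \<in> borel_measurable M"
    and c: "\<And>x. continuous_on UNIV (g x)"
    and w [measurable]: "w \<in> borel_measurable M"
  shows "(\<lambda>x. primitive g x (w x)) \<in> borel_measurable M"
proof -
  have J [measurable]: "(\<lambda>z. g (fst z) (snd z)) \<in> borel_measurable (M \<Otimes>\<^sub>M lborel)"
  proof (rule borel_measurable_caratheodory[where g="\<lambda>z. g (fst z)"])
    show "(\<lambda>z. g (fst z) t) \<in> borel_measurable (M \<Otimes>\<^sub>M lborel)" for t
      using measurable_compose[OF measurable_fst m] .
  qed (use c in auto)
  have e: "primitive g x t = (if 0 \<le> t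
      then (LINT \<tau>|lborel. (if 0 < \<tau> \<and> \<tau> < t then g x \<tau> else 0))
      else - (LINT \<tau>|lborel. (if t < \<tau> \<and> \<tau> < 0 then g x \<tau> else 0)))" for x t
    unfolding primitive_def interval_lebesgue_integral_def set_lebesgue_integral_def
    by (auto simp: einterval_iff indicator_def zero_ereal_def intro!: Bochner_Integration.integral_cong)
  show ?thesis unfolding e by measurable
qed

text \<open>Lebesgue measure is complete, so measurability passes between functions that agree
  almost everywhere. Either both are measurable and the usual congruence applies, or neither is and
  both integrals have the default value 0.\<close>

lemma lebesgue_integral_on_cong_AE:
  fixes f h :: "'a::euclidean_space \<Rightarrow> real"
  assumes \<Omega> [measurable]: "\<Omega> \<in> sets lebesgue" and eq: "AE x in lebesgue_on \<Omega>. f x = h x"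
  shows "(LINT x|lebesgue_on \<Omega>. f x) = (LINT x|lebesgue_on \<Omega>. h x)"
proof -
  have eq': "AE x in lebesgue. indicator \<Omega> x *\<^sub>R f x = indicator \<Omega> x *\<^sub>R h x"
    using eq by (subst (asm) AE_restrict_space_iff) (auto elim!: eventually_mono simp: indicator_def)
  then have eq'': "AE x in lebesgue. indicator \<Omega> x *\<^sub>R h x = indicator \<Omega> x *\<^sub>R f x"
    by eventually_elim auto
  have "(LINT x|lebesgue. indicator \<Omega> x *\<^sub>R f x) = (LINT x|lebesgue. indicator \<Omega> x *\<^sub>R h x)"
  proof (cases "(\<lambda>x. indicator \<Omega> x *\<^sub>R f x) \<in> borel_measurable lebesgue")
    case True
    then show ?thesis using borel_measurable_AE[OF True eq'] eq' by (intro integral_cong_AE)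
  next
    case False
    then have "(\<lambda>x. indicator \<Omega> x *\<^sub>R h x) \<notin> borel_measurable lebesgue"
      using borel_measurable_AE[OF _ eq''] by blast
    with False show ?thesis
      by (metis borel_measurable_integrable not_integrable_integral_eq)
  qed
  then show ?thesis by (simp add: integral_restrict_space)
qed

text \<open>The conditions hold at every point instead of almost every one, so that pointwise
  arguments need no exceptional sets. \<open>growth\<close> combines (H3) and (H4): the linear
  coefficient can be made arbitrarily small at the price of a multiple of the critical
  power.\<close>

locale superlinear_nonlinearity =
  fixes M :: "(real ^ 'n) measure" and g :: "real ^ 'n \<Rightarrow> real \<Rightarrow> real" and q :: real
  assumes q: "2 < q"
    and meas: "\<And>t. (\<lambda>x. g x t) \<in> borel_measurable M"
    and cont: "\<And>x. continuous_on UNIV (g x)"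
    and sign: "\<And>x t. t \<noteq> 0 \<Longrightarrow> 0 < g x t * t"
    and growth: "\<And>\<epsilon>. 0 < \<epsilon> \<Longrightarrow> \<exists>C\<ge>0. \<forall>x t. \<bar>g x t\<bar> \<le> \<epsilon> * \<bar>t\<bar> + C * \<bar>t\<bar> powr (q - 1)"
begin

lemma primitive_has_derivative: "(primitive g x has_real_derivative g x t) (at t)"
proof -
  define m where "m = \<bar>t\<bar> + 1"
  have "((\<lambda>u. LBINT y=ereal 0..ereal u. g x y) has_vector_derivative g x t) (at t within {- m..m})"
    by (rule interval_integral_FTC2) (auto simp: m_def intro: continuous_on_subset[OF cont])
  then have "(primitive g x has_vector_derivative g x t) (at t within {- m..m})"
    by (simp add: primitive_def[abs_def] zero_ereal_def)
  moreover have "at t within {- m..m} = at t"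
    by (rule at_within_interior) (auto simp: m_def)
  ultimately show ?thesis by (simp add: has_real_derivative_iff_has_vector_derivative)
qed

lemma primitive_0 [simp]: "primitive g x 0 = 0"
  by (simp add: primitive_def flip: zero_ereal_def)

text \<open>An intermediate point on the same side of 0 as t serves twice: its sign gives positivity
  of the primitive, and its size transfers growth bounds from \<open>g\<close> to the
  primitive.\<close>

lemma primitive_mean_value:
  assumes "t \<noteq> 0"
  obtains z where "\<bar>z\<bar> \<le> \<bar>t\<bar>" "0 < z * t" "primitive g x t = t * g x z"
proof (cases "0 < t")
  case True
  obtain z where "0 < z" "z < t" "primitive g x t - primitive g x 0 = (t - 0) * g x z"
    using MVT2[OF True, of "primitive g x" "g x"] primitive_has_derivative by blast
  then show ?thesis using that[of z] by simp
next
  case False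
  then have "t < 0" using assms by simp
  then obtain z where "t < z" "z < 0" "primitive g x 0 - primitive g x t = (0 - t) * g x z"
    using MVT2[of t 0 "primitive g x" "g x"] primitive_has_derivative by blast
  then show ?thesis using that[of z] by (simp add: mult_neg_neg)
qed

lemma primitive_pos: "t \<noteq> 0 \<Longrightarrow> 0 < primitive g x t"
proof -
  assume t: "t \<noteq> 0"
  then obtain z where z: "0 < z * t" "primitive g x t = t * g x z" by (rule primitive_mean_value)
  then have "0 < g x z * z" by (intro sign) auto
  with z show ?thesis by (auto simp: zero_less_mult_iff)
qed

lemma primitive_nonneg: "0 \<le> primitive g x t"
  using primitive_pos[of t x] by (cases "t = 0") auto

lemma primitive_le:
  assumes \<epsilon>: "0 \<le> \<epsilon>" and C: "0 \<le> C"
    and le: "\<And>t. \<bar>g x t\<bar> \<le> \<epsilon> * \<bar>t\<bar> + C * \<bar>t\<bar> powr (q - 1)"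
  shows "primitive g x t \<le> \<epsilon> * t\<^sup>2 + C * \<bar>t\<bar> powr q"
proof (cases "t = 0")
  case False
  then obtain z where z: "\<bar>z\<bar> \<le> \<bar>t\<bar>" "primitive g x t = t * g x z" by (rule primitive_mean_value)
  have "primitive g x t \<le> \<bar>t\<bar> * \<bar>g x z\<bar>" using z by (simp flip: abs_mult)
  also have "\<dots> \<le> \<bar>t\<bar> * (\<epsilon> * \<bar>t\<bar> + C * \<bar>t\<bar> powr (q - 1))"
    using z q \<epsilon> C by (intro mult_left_mono order_trans[OF le] add_mono powr_mono2) auto
  also have "\<dots> = \<epsilon> * t\<^sup>2 + C * (\<bar>t\<bar> powr 1 * \<bar>t\<bar> powr (q - 1))"
    using False by (simp add: algebra_simps power2_eq_square)
  also have "\<bar>t\<bar> powr 1 * \<bar>t\<bar> powr (q - 1) = \<bar>t\<bar> powr q"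
    by (simp only: powr_add[symmetric]) simp
  finally show ?thesis .
qed simp

context
  fixes u :: "real ^ 'n \<Rightarrow> real"
  assumes um [measurable]: "u \<in> borel_measurable M"
    and int2: "integrable M (\<lambda>x. (u x)\<^sup>2)"
    and intq: "integrable M (\<lambda>x. \<bar>u x\<bar> powr q)"
begin

lemma primitive_measurable [measurable]: "(\<lambda>x. primitive g x (\<zeta> * u x)) \<in> borel_measurable M"
  by (rule borel_measurable_primitive[OF meas cont]) measurable

lemma primitive_scaled_le:
  assumes "0 < \<zeta>" "0 \<le> \<epsilon>" "0 \<le> C" "\<And>t. \<bar>g x t\<bar> \<le> \<epsilon> * \<bar>t\<bar> + C * \<bar>t\<bar> powr (q - 1)"
  shows "primitive g x (\<zeta> * u x) \<le> \<epsilon> * \<zeta>\<^sup>2 * (u x)\<^sup>2 + C * \<zeta> powr q * \<bar>u x\<bar> powr q"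
  using primitive_le[OF assms(2-4), of "\<zeta> * u x"] assms(1)
  by (simp add: abs_mult powr_mult power_mult_distrib mult.assoc)

lemma primitive_integrable:
  assumes "0 < \<zeta>"
  shows "integrable M (\<lambda>x. primitive g x (\<zeta> * u x))"
proof -
  obtain C where C: "C \<ge> 0" "\<And>x t. \<bar>g x t\<bar> \<le> 1 * \<bar>t\<bar> + C * \<bar>t\<bar> powr (q - 1)"
    using growth[of 1] by auto
  have int: "integrable M (\<lambda>x. 1 * \<zeta>\<^sup>2 * (u x)\<^sup>2 + C * \<zeta> powr q * \<bar>u x\<bar> powr q)"
    using int2 intq by auto
  show ?thesis
  proof (rule Bochner_Integration.integrable_bound[OF int])
    show "AE x in M. norm (primitive g x (\<zeta> * u x)) \<le> norm (1 * \<zeta>\<^sup>2 * (u x)\<^sup>2 + C * \<zeta> powr q * \<bar>u x\<bar> powr q)"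
    proof (rule AE_I2)
      fix x
      have "primitive g x (\<zeta> * u x) \<le> 1 * \<zeta>\<^sup>2 * (u x)\<^sup>2 + C * \<zeta> powr q * \<bar>u x\<bar> powr q"
        by (rule primitive_scaled_le[OF assms _ C]) simp
      then show "norm (primitive g x (\<zeta> * u x)) \<le> norm (1 * \<zeta>\<^sup>2 * (u x)\<^sup>2 + C * \<zeta> powr q * \<bar>u x\<bar> powr q)"
        using primitive_nonneg[of x "\<zeta> * u x"] by simp
    qed
  qed measurable
qed

lemma integral_primitive_le:
  assumes "0 < \<zeta>" "0 \<le> \<epsilon>" "0 \<le> C" "\<And>x t. \<bar>g x t\<bar> \<le> \<epsilon> * \<bar>t\<bar> + C * \<bar>t\<bar> powr (q - 1)"
  shows "(LINT x|M. primitive g x (\<zeta> * u x))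
    \<le> \<epsilon> * \<zeta>\<^sup>2 * (LINT x|M. (u x)\<^sup>2) + C * \<zeta> powr q * (LINT x|M. \<bar>u x\<bar> powr q)"
proof -
  have "(LINT x|M. primitive g x (\<zeta> * u x))
      \<le> (LINT x|M. \<epsilon> * \<zeta>\<^sup>2 * (u x)\<^sup>2 + C * \<zeta> powr q * \<bar>u x\<bar> powr q)"
    using int2 intq primitive_integrable[OF assms(1)]
    by (intro integral_mono primitive_scaled_le assms) auto
  also have "\<dots> = \<epsilon> * \<zeta>\<^sup>2 * (LINT x|M. (u x)\<^sup>2) + C * \<zeta> powr q * (LINT x|M. \<bar>u x\<bar> powr q)"
    using int2 intq by simp
  finally show ?thesis .
qed

lemma integral_primitive_pos:
  assumes \<zeta>: "0 < \<zeta>" and nz: "\<not> (AE x in M. u x = 0)"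
  shows "0 < (LINT x|M. primitive g x (\<zeta> * u x))"
proof -
  have "(LINT x|M. primitive g x (\<zeta> * u x)) \<noteq> 0"
  proof
    assume "(LINT x|M. primitive g x (\<zeta> * u x)) = 0"
    then have "AE x in M. primitive g x (\<zeta> * u x) = 0"
      by (subst (asm) integral_nonneg_eq_0_iff_AE[OF primitive_integrable[OF \<zeta>]])
        (auto simp: primitive_nonneg)
    then have "AE x in M. u x = 0"
    proof eventually_elim
      case (elim x)
      then show ?case using primitive_pos[of "\<zeta> * u x" x] \<zeta> by auto
    qed
    with nz show False by contradiction
  qed
  moreover have "0 \<le> (LINT x|M. primitive g x (\<zeta> * u x))"
    by (simp add: primitive_nonneg)
  ultimately show ?thesis by simp
qed

text \<open>Differentiation under the integral by dominated convergence along sequences. By the mean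
  value theorem each difference quotient is a value of the derivative at a parameter in (0,
  2\<zeta>), and on this bounded interval \<open>w\<close> dominates independently of the
  parameter.\<close>

lemma integral_primitive_differentiable:
  assumes \<zeta>: "0 < \<zeta>"
  shows "((\<lambda>\<zeta>. LINT x|M. primitive g x (\<zeta> * u x)) has_real_derivative
    (LINT x|M. g x (\<zeta> * u x) * u x)) (at \<zeta>)"
proof -
  define H where "H = (\<lambda>\<zeta>. LINT x|M. primitive g x (\<zeta> * u x))"
  define S where "S = {0<..<2 * \<zeta>}"
  have S: "open S" "\<zeta> \<in> S" using \<zeta> by (auto simp: S_def)
  obtain C where C: "C \<ge> 0" "\<And>x t. \<bar>g x t\<bar> \<le> 1 * \<bar>t\<bar> + C * \<bar>t\<bar> powr (q - 1)"
    using growth[of 1] by auto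
  have dx: "((\<lambda>\<zeta>. primitive g x (\<zeta> * u x)) has_real_derivative g x (y * u x) * u x) (at y)" for x y
  proof -
    have "((\<lambda>y. y * u x) has_real_derivative u x) (at y)"
      by (auto intro!: derivative_eq_intros)
    from DERIV_chain2[where f="primitive g x" and g="\<lambda>y. y * u x", OF primitive_has_derivative this]
    show ?thesis .
  qed
  define w where "w = (\<lambda>x. 2 * \<zeta> * (u x)\<^sup>2 + C * (2 * \<zeta>) powr (q - 1) * \<bar>u x\<bar> powr q)"
  have wint: "integrable M w" unfolding w_def using int2 intq by auto
  have gw: "\<bar>g x (y * u x) * u x\<bar> \<le> w x" if "y \<in> S" for x y
  proof -
    have y: "0 < y" "y \<le> 2 * \<zeta>" using that by (auto simp: S_def)
    have "\<bar>g x (y * u x) * u x\<bar> \<le> (1 * \<bar>y * u x\<bar> + C * \<bar>y * u x\<bar> powr (q - 1)) * \<bar>u x\<bar>"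
      unfolding abs_mult[of "g x (y * u x)"] by (intro mult_right_mono C(2)) auto
    also have "\<dots> = y * (u x)\<^sup>2 + C * y powr (q - 1) * (\<bar>u x\<bar> powr (q - 1) * \<bar>u x\<bar> powr 1)"
      using y by (simp add: abs_mult powr_mult algebra_simps power2_eq_square)
    also have "\<bar>u x\<bar> powr (q - 1) * \<bar>u x\<bar> powr 1 = \<bar>u x\<bar> powr q"
      by (simp only: powr_add[symmetric]) simp
    also have "y * (u x)\<^sup>2 + C * y powr (q - 1) * \<bar>u x\<bar> powr q \<le> w x"
      unfolding w_def using y C q by (intro add_mono mult_right_mono mult_left_mono powr_mono2) auto
    finally show ?thesis .
  qed
  have "((\<lambda>y. (H y - H \<zeta>) / (y - \<zeta>)) \<longlongrightarrow> (LINT x|M. g x (\<zeta> * u x) * u x)) (at \<zeta> within S)"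
    unfolding tendsto_at_iff_sequentially comp_def
  proof (intro allI impI)
    fix X :: "nat \<Rightarrow> real" assume X: "\<forall>i. X i \<in> S - {\<zeta>}" "X \<longlonglongrightarrow> \<zeta>"
    let ?D = "\<lambda>i x. (primitive g x (X i * u x) - primitive g x (\<zeta> * u x)) / (X i - \<zeta>)"
    have pos: "0 < X i" for i using X by (auto simp: S_def)
    have Dlim: "(\<lambda>i. ?D i x) \<longlonglongrightarrow> g x (\<zeta> * u x) * u x" for x
    proof -
      have "((\<lambda>y. (primitive g x (y * u x) - primitive g x (\<zeta> * u x)) / (y - \<zeta>)) \<longlongrightarrow> g x (\<zeta> * u x) * u x) (at \<zeta>)"
        using dx[of x \<zeta>] by (simp add: has_field_derivative_iff)
      then show ?thesis
        using X by (auto simp: tendsto_at_iff_sequentially comp_def)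
    qed
    have "(\<lambda>i. LINT x|M. ?D i x) \<longlonglongrightarrow> (LINT x|M. g x (\<zeta> * u x) * u x)"
    proof (rule integral_dominated_convergence[where w=w])
      show "(\<lambda>x. g x (\<zeta> * u x) * u x) \<in> borel_measurable M"
        by (intro borel_measurable_times um borel_measurable_caratheodory[OF meas cont]) measurable
      show "?D i \<in> borel_measurable M" for i by measurable
      show "integrable M w" by (rule wint)
      show "AE x in M. (\<lambda>i. ?D i x) \<longlonglongrightarrow> g x (\<zeta> * u x) * u x" using Dlim by simp
      fix i
      show "AE x in M. norm (?D i x) \<le> w x"
      proof (rule AE_I2)
        fix x
        have "\<exists>z\<in>S. ?D i x = g x (z * u x) * u x"
        proof (cases "\<zeta> < X i")
          case True
          obtain z where z: "\<zeta> < z" "z < X i"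
            "primitive g x (X i * u x) - primitive g x (\<zeta> * u x) = (X i - \<zeta>) * (g x (z * u x) * u x)"
            using MVT2[OF True, of "\<lambda>y. primitive g x (y * u x)" "\<lambda>y. g x (y * u x) * u x"] dx by blast
          then have "z \<in> S" using X(1)[rule_format, of i] \<zeta> by (auto simp: S_def)
          then show ?thesis using z True by (intro bexI[of _ z]) auto
        next
          case False
          then have lt: "X i < \<zeta>" using X(1)[rule_format, of i] by auto
          obtain z where z: "X i < z" "z < \<zeta>"
            "primitive g x (\<zeta> * u x) - primitive g x (X i * u x) = (\<zeta> - X i) * (g x (z * u x) * u x)"
            using MVT2[OF lt, of "\<lambda>y. primitive g x (y * u x)" "\<lambda>y. g x (y * u x) * u x"] dx by blast
          then have "z \<in> S" using X(1)[rule_format, of i] \<zeta> by (auto simp: S_def)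
          moreover have "?D i x = g x (z * u x) * u x"
            using z lt by (simp add: field_simps)
          ultimately show ?thesis by (intro bexI[of _ z])
        qed
        then obtain z where z: "z \<in> S" "?D i x = g x (z * u x) * u x" by blast
        show "norm (?D i x) \<le> w x"
          using gw[OF z(1), of x] unfolding z(2) real_norm_def .
      qed
    qed
    moreover have "(LINT x|M. ?D i x) = (H (X i) - H \<zeta>) / (X i - \<zeta>)" for i
      unfolding H_def using primitive_integrable[OF pos[of i]] primitive_integrable[OF \<zeta>] by simp
    ultimately show "(\<lambda>i. (H (X i) - H \<zeta>) / (X i - \<zeta>)) \<longlonglongrightarrow> (LINT x|M. g x (\<zeta> * u x) * u x)"
      by (simp only:)
  qed
  then show ?thesis
    using at_within_open[OF S(2,1)] by (simp add: has_field_derivative_iff H_def)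
qed

end

end

subsection \<open>Extremal parameters and nonexistence\<close>

text \<open>The parameter described is the minimum of \<open>f / H\<close> over the positive half-line.\<close>

lemma extremal_parameter_ge:
  fixes f H :: "real \<Rightarrow> real"
  assumes df: "\<And>x. 0 < x \<Longrightarrow> f differentiable (at x)"
    and dH: "\<And>x. 0 < x \<Longrightarrow> H differentiable (at x)"
    and H: "\<And>x. 0 < x \<Longrightarrow> 0 < H x"
    and c: "0 \<le> c" "\<And>x. 0 < x \<Longrightarrow> c * H x \<le> f x"
    and zero: "\<And>R. 0 < R \<Longrightarrow> eventually (\<lambda>x. R * H x < f x) (at_right 0)"
    and infty: "\<And>R. 0 < R \<Longrightarrow> eventually (\<lambda>x. R * H x < f x) at_top"
  shows "c \<le> (THE l. l \<ge> 0 \<and> (\<exists>\<zeta> > 0. f \<zeta> - l * H \<zeta> = 0 \<and>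
     ((\<lambda>\<zeta>. f \<zeta> - l * H \<zeta>) has_real_derivative 0) (at \<zeta>) \<and>
     ereal (f \<zeta> - l * H \<zeta>) = (INF \<rho> \<in> {0<..}. ereal (f \<rho> - l * H \<rho>))))"
proof -
  define P where "P = (\<lambda>l. l \<ge> 0 \<and> (\<exists>\<zeta> > 0. f \<zeta> - l * H \<zeta> = 0 \<and>
     ((\<lambda>\<zeta>. f \<zeta> - l * H \<zeta>) has_real_derivative 0) (at \<zeta>) \<and>
     ereal (f \<zeta> - l * H \<zeta>) = (INF \<rho> \<in> {0<..}. ereal (f \<rho> - l * H \<rho>))))"
  have nonneg: "l * H \<rho> \<le> f \<rho>" if "P l" "0 < \<rho>" for l \<rho>
  proof -
    obtain \<zeta> where "f \<zeta> - l * H \<zeta> = 0"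
      "ereal (f \<zeta> - l * H \<zeta>) = (INF \<rho> \<in> {0<..}. ereal (f \<rho> - l * H \<rho>))"
      using \<open>P l\<close> unfolding P_def by auto
    then have "ereal 0 \<le> ereal (f \<rho> - l * H \<rho>)"
      using that(2) by (auto intro: INF_lower)
    then show ?thesis by simp
  qed
  have touch: "\<exists>\<zeta>>0. f \<zeta> = l * H \<zeta>" if "P l" for l using that unfolding P_def by auto
  \<comment> \<open>At the point where one admissible parameter is attained, the inequality for the
    other compares the same quotient f/H. By symmetry the two agree, so \<open>THE\<close> denotes
    an actual value.\<close>
  have uniq: "l \<le> m" if "P l" "P m" for l m
  proof -
    obtain \<zeta> where "\<zeta> > 0" "f \<zeta> = m * H \<zeta>" using touch[OF \<open>P m\<close>] by auto
    then show ?thesis using nonneg[OF \<open>P l\<close>, of \<zeta>] H[of \<zeta>] by simp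
  qed
  have "\<exists>l. P l"
  proof -
    \<comment> \<open>\<open>R\<close> is at least the quotient f/H at 1. Outside the compact
      interval \<open>K\<close>, which contains 1, the quotient exceeds \<open>R\<close>, so a
      minimum over \<open>K\<close> is a minimum over the whole positive half-line.\<close>
    define R where "R = \<bar>f 1 / H 1\<bar> + 1"
    have R: "R > 0" "f 1 / H 1 \<le> R" unfolding R_def by linarith+
    obtain z1 where z1: "z1 > 0" "\<And>x. 0 < x \<Longrightarrow> x < z1 \<Longrightarrow> R * H x < f x"
      using zero[OF R(1)] unfolding eventually_at_right_field by auto
    obtain z2 where z2: "\<And>x. z2 < x \<Longrightarrow> R * H x < f x"
      using infty[OF R(1)] unfolding eventually_at_top_dense by auto
    define K where "K = {min z1 1..max z2 1}"
    have "continuous_on K (\<lambda>x. f x / H x)"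
    proof (rule continuous_at_imp_continuous_on, rule ballI)
      fix x assume "x \<in> K"
      then have x: "0 < x" using z1 by (auto simp: K_def)
      then show "isCont (\<lambda>x. f x / H x) x"
        using differentiable_imp_continuous_within[OF df[OF x]]
          differentiable_imp_continuous_within[OF dH[OF x]] H[OF x]
        by (intro continuous_divide) auto
    qed
    moreover have "compact K" "1 \<in> K" by (auto simp: K_def)
    ultimately obtain \<zeta> where \<zeta>: "\<zeta> \<in> K" "\<And>x. x \<in> K \<Longrightarrow> f \<zeta> / H \<zeta> \<le> f x / H x"
      using continuous_attains_inf[of K "\<lambda>x. f x / H x"] by blast
    have \<zeta>0: "\<zeta> > 0" using \<zeta>(1) z1 by (auto simp: K_def)
    define l where "l = f \<zeta> / H \<zeta>"
    have le: "l * H x \<le> f x" if x: "0 < x" for x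
    proof (cases "x \<in> K")
      case True
      then show ?thesis using \<zeta>(2)[OF True] H[OF x] by (simp add: l_def pos_le_divide_eq)
    next
      case False
      then have "R * H x < f x" using z1 z2 x by (auto simp: K_def)
      moreover have "l \<le> R" using \<zeta>(2)[OF \<open>1 \<in> K\<close>] R by (simp add: l_def)
      ultimately show ?thesis using H[OF x] by (meson less_eq_real_def mult_right_mono order_trans)
    qed
    have eq0: "f \<zeta> - l * H \<zeta> = 0" using H[OF \<zeta>0] by (simp add: l_def)
    have l0: "l \<ge> 0"
      unfolding l_def using c(2)[OF \<zeta>0] c(1) H[OF \<zeta>0]
      by (intro divide_nonneg_pos) (auto intro: order_trans[of _ "c * H \<zeta>"])
    obtain Df DH where D: "(f has_real_derivative Df) (at \<zeta>)" "(H has_real_derivative DH) (at \<zeta>)"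
      using df[OF \<zeta>0] dH[OF \<zeta>0] unfolding real_differentiable_def by auto
    define D where "D = Df - l * DH"
    have D: "((\<lambda>\<zeta>. f \<zeta> - l * H \<zeta>) has_real_derivative D) (at \<zeta>)"
      unfolding D_def using D by (intro DERIV_diff DERIV_cmult)
    moreover have "D = 0"
      by (rule DERIV_local_min[OF D \<zeta>0]) (auto simp: eq0 abs_less_iff intro!: le)
    ultimately have "((\<lambda>\<zeta>. f \<zeta> - l * H \<zeta>) has_real_derivative 0) (at \<zeta>)" by simp
    moreover have "ereal (f \<zeta> - l * H \<zeta>) = (INF \<rho> \<in> {0<..}. ereal (f \<rho> - l * H \<rho>))"
    proof (rule antisym)
      show "ereal (f \<zeta> - l * H \<zeta>) \<le> (INF \<rho> \<in> {0<..}. ereal (f \<rho> - l * H \<rho>))"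
        using le by (intro INF_greatest) (auto simp: eq0)
      show "(INF \<rho> \<in> {0<..}. ereal (f \<rho> - l * H \<rho>)) \<le> ereal (f \<zeta> - l * H \<zeta>)"
        using \<zeta>0 by (intro INF_lower) auto
    qed
    ultimately have "P l" unfolding P_def using l0 \<zeta>0 eq0 by blast
    then show ?thesis ..
  qed
  then have "\<exists>!l. P l" using uniq by (blast intro: antisym)
  then have "P (THE l. P l)" by (rule theI')
  then obtain \<zeta> where "\<zeta> > 0" "f \<zeta> = (THE l. P l) * H \<zeta>" using touch by blast
  then have "c \<le> (THE l. P l)" using c(2)[of \<zeta>] H[of \<zeta>] by simp
  then show ?thesis by (simp add: P_def)
qed

text \<open>On the exceptional null set \<open>g\<close> is replaced by the pure power \<open>t \<mapsto> \<bar>t\<bar> powr (q - 2) * t\<close>.\<close>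

lemma nonlinearity_representative:
  fixes g :: "real ^ 'n \<Rightarrow> real \<Rightarrow> real"
  assumes q: "2 < q" and \<Omega> [measurable]: "\<Omega> \<in> sets lebesgue"
    and car: "caratheodory_on \<Omega> g" and g0: "AE x in lebesgue_on \<Omega>. g x 0 = 0"
    and sign: "AE x in lebesgue_on \<Omega>. (\<forall>t>0. g x t > 0) \<and> (\<forall>t<0. g x t < 0)"
    and growth: "\<exists>c>0. \<exists>p. 2 < p \<and> p < q \<and>
         (AE x in lebesgue_on \<Omega>. \<forall>t. \<bar>g x t\<bar> \<le> c * (1 + \<bar>t\<bar> powr (p - 1)))"
    and small: "uniform_limit \<Omega> (\<lambda>t x. g x t / \<bar>t\<bar>) (\<lambda>x. 0) (at 0)"
  obtains h where "AE x in lebesgue_on \<Omega>. g x = h x" "superlinear_nonlinearity (lebesgue_on \<Omega>) h q"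
proof -
  obtain c p where c: "c > 0" and p: "2 < p" "p < q"
    and gr: "AE x in lebesgue_on \<Omega>. \<forall>t. \<bar>g x t\<bar> \<le> c * (1 + \<bar>t\<bar> powr (p - 1))"
    using growth by blast
  have cont: "AE x in lebesgue_on \<Omega>. continuous_on UNIV (g x)"
    and m [measurable]: "\<And>t. (\<lambda>x. g x t) \<in> borel_measurable (lebesgue_on \<Omega>)"
    using car by (auto simp: caratheodory_on_def)
  have "AE x in lebesgue_on \<Omega>. continuous_on UNIV (g x) \<and> g x 0 = 0 \<and>
      ((\<forall>t>0. g x t > 0) \<and> (\<forall>t<0. g x t < 0)) \<and> (\<forall>t. \<bar>g x t\<bar> \<le> c * (1 + \<bar>t\<bar> powr (p - 1)))"
    using cont g0 sign gr by eventually_elim blast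
  then obtain N where good: "\<And>x. x \<in> space (lebesgue_on \<Omega>) - N \<Longrightarrow> continuous_on UNIV (g x) \<and> g x 0 = 0 \<and>
      ((\<forall>t>0. g x t > 0) \<and> (\<forall>t<0. g x t < 0)) \<and> (\<forall>t. \<bar>g x t\<bar> \<le> c * (1 + \<bar>t\<bar> powr (p - 1)))"
    and N: "N \<in> null_sets (lebesgue_on \<Omega>)"
    by (rule AE_E3) blast
  define P where "P = \<Omega> - N"
  have good: "continuous_on UNIV (g x)" "g x 0 = 0" "\<And>t. 0 < t \<Longrightarrow> 0 < g x t" "\<And>t. t < 0 \<Longrightarrow> g x t < 0"
    "\<And>t. \<bar>g x t\<bar> \<le> c * (1 + \<bar>t\<bar> powr (p - 1))" "x \<in> \<Omega>" if "x \<in> P" for x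
    using good[of x] that by (auto simp: P_def)
  define d where "d = (\<lambda>t :: real. \<bar>t\<bar> powr (q - 2) * t)"
  define h where "h = (\<lambda>x. if x \<in> P then g x else d)"
  have "AE x in lebesgue_on \<Omega>. g x = h x"
    using AE_not_in[OF N] by (rule AE_mp) (auto simp: h_def P_def)
  moreover have "superlinear_nonlinearity (lebesgue_on \<Omega>) h q"
  proof
    show "2 < q" by fact
    show "(\<lambda>x. h x t) \<in> borel_measurable (lebesgue_on \<Omega>)" for t
    proof -
      have "N \<in> sets (lebesgue_on \<Omega>)" using N by auto
      then have "{x \<in> space (lebesgue_on \<Omega>). x \<notin> N} \<in> sets (lebesgue_on \<Omega>)"
        using sets.compl_sets[of N "lebesgue_on \<Omega>"] by (simp add: set_diff_eq)
      then have "(\<lambda>x. if x \<notin> N then g x t else d t) \<in> borel_measurable (lebesgue_on \<Omega>)"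
        by (intro measurable_If m) auto
      then show ?thesis
        by (rule measurable_cong[THEN iffD1, rotated]) (simp add: h_def P_def)
    qed
    have "continuous_on UNIV (\<lambda>t :: real. \<bar>t\<bar> powr (q - 2))"
      by (rule continuous_on_powr') (use q in \<open>auto intro!: continuous_intros\<close>)
    then have "continuous_on UNIV d" unfolding d_def by (intro continuous_on_mult continuous_on_id)
    then show "continuous_on UNIV (h x)" for x using good(1)[of x] by (simp add: h_def)
    show "0 < h x t * t" if "t \<noteq> 0" for x t
    proof (cases "x \<in> P")
      case True
      then show ?thesis using good(3,4)[OF True, of t] that
        by (cases "0 < t") (auto simp: h_def mult_neg_neg)
    next
      case False
      have "0 < \<bar>t\<bar> powr (q - 2) * t\<^sup>2" using that by (intro mult_pos_pos) auto
      with False show ?thesis by (simp add: h_def d_def mult.assoc power2_eq_square)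
    qed
    fix \<epsilon> :: real assume \<epsilon>: "0 < \<epsilon>"
    have "eventually (\<lambda>t. \<forall>x\<in>\<Omega>. dist (g x t / \<bar>t\<bar>) 0 < \<epsilon>) (at 0)"
      using small \<epsilon> by (auto simp: uniform_limit_iff)
    then obtain \<delta> where \<delta>: "\<delta> > 0" "\<And>t x. t \<noteq> 0 \<Longrightarrow> \<bar>t\<bar> < \<delta> \<Longrightarrow> x \<in> \<Omega> \<Longrightarrow> \<bar>g x t\<bar> / \<bar>t\<bar> < \<epsilon>"
      unfolding eventually_at by (auto simp: dist_real_def)
    \<comment> \<open>The quotient is what the region |t| \<ge> \<delta> requires: with |t| =
      \<delta>\<tau> and \<tau> \<ge> 1, both 1 and \<tau>^(p-1) are at most \<tau>^(q-1). The added
      1 covers the pure power used on the exceptional set.\<close>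
    define C where "C = c * (1 + \<delta> powr (p - 1)) / \<delta> powr (q - 1) + 1"
    have C: "C \<ge> 1" "c * (1 + \<delta> powr (p - 1)) / \<delta> powr (q - 1) \<le> C"
      using c \<delta> by (auto simp: C_def)
    have "\<bar>h x t\<bar> \<le> \<epsilon> * \<bar>t\<bar> + C * \<bar>t\<bar> powr (q - 1)" for x t
    proof -
      consider "t = 0" | "t \<noteq> 0" "x \<notin> P" | "t \<noteq> 0" "x \<in> P" "\<bar>t\<bar> < \<delta>" | "t \<noteq> 0" "x \<in> P" "\<delta> \<le> \<bar>t\<bar>"
        by fastforce
      then show ?thesis
      proof cases
        case 1
        then show ?thesis by (simp add: h_def d_def good(2))
      next
        case 2
        have "\<bar>h x t\<bar> = \<bar>t\<bar> powr (q - 2) * \<bar>t\<bar> powr 1" using 2 by (simp add: h_def d_def abs_mult)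
        also have "\<dots> = \<bar>t\<bar> powr (q - 1)" by (simp only: powr_add[symmetric]) simp
        also have "\<dots> \<le> C * \<bar>t\<bar> powr (q - 1)"
          using mult_right_mono[OF C(1), of "\<bar>t\<bar> powr (q - 1)"] by simp
        also have "\<dots> \<le> \<epsilon> * \<bar>t\<bar> + C * \<bar>t\<bar> powr (q - 1)" using \<epsilon> by simp
        finally show ?thesis .
      next
        case 3
        have "\<bar>g x t\<bar> / \<bar>t\<bar> < \<epsilon>" using \<delta>(2)[of t x] 3 good(6) by blast
        then have "\<bar>h x t\<bar> \<le> \<epsilon> * \<bar>t\<bar>" using 3 by (simp add: h_def field_simps)
        also have "\<dots> \<le> \<epsilon> * \<bar>t\<bar> + C * \<bar>t\<bar> powr (q - 1)" using C by simp
        finally show ?thesis .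
      next
        case 4
        define \<tau> where "\<tau> = \<bar>t\<bar> / \<delta>"
        have \<tau>: "1 \<le> \<tau>" "\<bar>t\<bar> = \<delta> * \<tau>" using 4 \<delta> by (auto simp: \<tau>_def)
        have "\<bar>h x t\<bar> \<le> c * (1 + \<bar>t\<bar> powr (p - 1))" using 4 good(5) by (simp add: h_def)
        also have "\<bar>t\<bar> powr (p - 1) = \<delta> powr (p - 1) * \<tau> powr (p - 1)"
          unfolding \<tau>(2) by (rule powr_mult)
        also have "c * (1 + \<delta> powr (p - 1) * \<tau> powr (p - 1)) \<le> c * (\<tau> powr (q - 1) + \<delta> powr (p - 1) * \<tau> powr (q - 1))"
          using c \<tau> q p by (intro mult_left_mono add_mono powr_mono ge_one_powr_ge_zero) auto
        also have "\<dots> = c * (1 + \<delta> powr (p - 1)) * \<tau> powr (q - 1)" by (simp add: algebra_simps)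
        also have "\<tau> powr (q - 1) = \<bar>t\<bar> powr (q - 1) / \<delta> powr (q - 1)"
          unfolding \<tau>_def by (rule powr_divide)
        also have "c * (1 + \<delta> powr (p - 1)) * (\<bar>t\<bar> powr (q - 1) / \<delta> powr (q - 1))
            = c * (1 + \<delta> powr (p - 1)) / \<delta> powr (q - 1) * \<bar>t\<bar> powr (q - 1)" by simp
        also have "\<dots> \<le> C * \<bar>t\<bar> powr (q - 1)" by (intro mult_right_mono C) simp
        also have "\<dots> \<le> \<epsilon> * \<bar>t\<bar> + C * \<bar>t\<bar> powr (q - 1)" using \<epsilon> by simp
        finally show ?thesis .
      qed
    qed
    then show "\<exists>C\<ge>0. \<forall>x t. \<bar>h x t\<bar> \<le> \<epsilon> * \<bar>t\<bar> + C * \<bar>t\<bar> powr (q - 1)"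
      using C by (intro exI[of _ C]) auto
  qed
  ultimately show thesis by (rule that)
qed

section \<open>Fibre maps of the energy and the lower bound for the extremal parameter\<close>

lemma X0_norm_scale: "X0_norm s \<Omega> (\<lambda>x. \<zeta> * u x) = \<bar>\<zeta>\<bar> * X0_norm s \<Omega> u"
proof -
  have "X0_inner s \<Omega> (\<lambda>x. \<zeta> * u x) (\<lambda>x. \<zeta> * u x) = \<zeta>\<^sup>2 * X0_inner s \<Omega> u u"
    unfolding X0_inner_def set_integral_mult_right[symmetric]
    by (intro arg_cong[where f="set_lebesgue_integral _ _"])
      (auto simp: power2_eq_square algebra_simps)
  then show ?thesis by (simp add: X0_norm_def real_sqrt_mult)
qed

text \<open>This splits the fibre map as f - l H, the shape of \<open>extremal_parameter_ge\<close>.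
  It covers every real \<open>\<zeta>\<close>, hence the absolute value, so that it gives an
  equality of functions by which the derivative and the infimum inside \<open>lambda0\<close> can be
  rewritten.\<close>

lemma fiber_eq:
  fixes g :: "real ^ 'n \<Rightarrow> real \<Rightarrow> real"
  assumes \<Omega> [measurable]: "\<Omega> \<in> sets lebesgue" and gh: "AE x in lebesgue_on \<Omega>. g x = h x"
    and q: "crit_exp (real CARD('n)) s > 2"
  defines "q \<equiv> crit_exp (real CARD('n)) s"
  shows "fiber s \<Omega> g a b l u \<zeta> =
     (a / 2 * (X0_norm s \<Omega> u * \<zeta>)\<^sup>2 + b / 4 * (X0_norm s \<Omega> u * \<zeta>) ^ 4
       - (LINT x|lebesgue_on \<Omega>. \<bar>u x\<bar> powr q) / q * \<bar>\<zeta>\<bar> powr q)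
     - l * (LINT x|lebesgue_on \<Omega>. primitive h x (\<zeta> * u x))"
proof -
  have 1: "(LINT x|lebesgue_on \<Omega>. primitive g x (\<zeta> * u x)) = (LINT x|lebesgue_on \<Omega>. primitive h x (\<zeta> * u x))"
    by (rule lebesgue_integral_on_cong_AE[OF \<Omega>])
      (use gh in \<open>eventually_elim, auto simp: primitive_def\<close>)
  have "Lq_norm \<Omega> q (\<lambda>x. \<zeta> * u x) powr q = (LINT x|lebesgue_on \<Omega>. \<bar>\<zeta> * u x\<bar> powr q)"
    using q by (simp add: Lq_norm_def powr_powr q_def)
  also have "\<dots> = \<bar>\<zeta>\<bar> powr q * (LINT x|lebesgue_on \<Omega>. \<bar>u x\<bar> powr q)"
    by (simp add: abs_mult powr_mult)
  finally have 2: "Lq_norm \<Omega> q (\<lambda>x. \<zeta> * u x) powr q = \<bar>\<zeta>\<bar> powr q * (LINT x|lebesgue_on \<Omega>. \<bar>u x\<bar> powr q)" .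
  show ?thesis
    unfolding fiber_def energy_def Let_def q_def[symmetric] 1 2 X0_norm_scale
    by (simp add: power_mult_distrib mult_ac)
qed

lemma powr_le_power2_plus_power4:
  fixes t q :: real
  assumes "0 \<le> t" "2 < q" "q < 4"
  shows "t powr q \<le> t\<^sup>2 + t ^ 4"
proof (cases "t \<le> 1")
  case True
  have "t powr q \<le> t powr 2"
  proof (cases "t = 0")
    case False
    then show ?thesis using True assms by (intro powr_mono') auto
  qed simp
  then show ?thesis using assms by (simp add: powr_numeral add_increasing2)
next
  case False
  then have "t powr q \<le> t powr 4" using assms by (intro powr_mono) auto
  then show ?thesis using assms by (simp add: powr_numeral add_increasing)
qed

text \<open>With T the norm of \<open>u\<close>, coercivity gives f(x) \<ge> (d/4)((Tx)^2 + (Tx)^4),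
  while growth gives H(x) \<le> m((Tx)^2 + (Tx)^4). The quotient f/H is therefore at least d/(4m), a
  bound free of \<open>u\<close>; behaviour at 0 and at infinity ensures that its minimum is
  attained.\<close>

lemma lambda0_ge:
  fixes g h :: "real ^ 'n \<Rightarrow> real \<Rightarrow> real" and \<Omega> :: "(real ^ 'n) set"
  assumes s: "0 < s" "s < 1" and N: "real CARD('n) > 4 * s"
    and \<Omega>: "open \<Omega>" "bounded \<Omega>" "\<Omega> \<noteq> {}" and u: "u \<in> X0_nonzero s \<Omega>"
  defines "q \<equiv> crit_exp (real CARD('n)) s" and "K \<equiv> S_const s \<Omega> powr (- (crit_exp (real CARD('n)) s / 2))"
  assumes gh: "AE x in lebesgue_on \<Omega>. g x = h x"
    and h: "superlinear_nonlinearity (lebesgue_on \<Omega>) h q"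
    and C: "0 \<le> C" "\<And>x t. \<bar>h x t\<bar> \<le> 1 * \<bar>t\<bar> + C * \<bar>t\<bar> powr (q - 1)"
    and d: "0 < d" "\<And>t. 0 \<le> t \<Longrightarrow> d * (t\<^sup>2 + t ^ 4) \<le> a * t\<^sup>2 + b * t ^ 4 - K * t powr q"
  shows "d / 4 / (measure lebesgue \<Omega> + K + C * K + 1) \<le> lambda0 s \<Omega> g a b u"
proof -
  interpret superlinear_nonlinearity "lebesgue_on \<Omega>" h q by (rule h)
  have \<Omega>m: "\<Omega> \<in> sets lebesgue" using \<Omega> by auto
  have q24: "2 < q" "q < 4" unfolding q_def using crit_exp_bounds[OF s(1) N] by auto
  have uX: "u \<in> X0_space s \<Omega>" using u by (simp add: X0_nonzero_def)
  have um: "u \<in> borel_measurable (lebesgue_on \<Omega>)" and i2: "integrable (lebesgue_on \<Omega>) (\<lambda>x. (u x)\<^sup>2)"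
    using uX by (auto simp: X0_space_def intro: measurable_restrict_space1)
  have iq: "integrable (lebesgue_on \<Omega>) (\<lambda>x. \<bar>u x\<bar> powr q)"
    unfolding q_def by (rule sobolev_integrable[OF s(1) N \<Omega>m \<Omega>(2) uX])
  have nz: "\<not> (AE x in lebesgue_on \<Omega>. u x = 0)"
    using AE_zero_if_zero_on[OF \<Omega>m uX] u by (auto simp: X0_nonzero_def)
  define T where "T = X0_norm s \<Omega> u"
  define A where "A = (LINT x|lebesgue_on \<Omega>. (u x)\<^sup>2)"
  define J where "J = (LINT x|lebesgue_on \<Omega>. \<bar>u x\<bar> powr q)"
  define H where "H = (\<lambda>\<zeta>. LINT x|lebesgue_on \<Omega>. primitive h x (\<zeta> * u x))"
  define f where "f = (\<lambda>\<zeta>. a / 2 * (T * \<zeta>)\<^sup>2 + b / 4 * (T * \<zeta>) ^ 4 - J / q * \<bar>\<zeta>\<bar> powr q)"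
  define m where "m = measure lebesgue \<Omega> + K + C * K + 1"
  have T: "T > 0" unfolding T_def by (rule X0_nonzero_pos(3)[OF s(1) N \<Omega>m \<Omega>(2) u])
  have A0: "A \<ge> 0" and J0: "J \<ge> 0" by (simp_all add: A_def J_def)
  have K0: "K \<ge> 0" by (simp add: K_def)
  have J: "J \<le> K * T powr q"
    using critical_integral_le[OF s N \<Omega> u] by (simp add: J_def K_def T_def q_def)
  have AT: "A \<le> (measure lebesgue \<Omega> + K) * T\<^sup>2"
    using poincare_inequality[OF s N \<Omega> u] by (simp add: A_def K_def T_def)
  have m: "m > 0" using K0 C by (simp add: m_def add_nonneg_pos)
  have fge: "d / 4 * ((T * x)\<^sup>2 + (T * x) ^ 4) \<le> f x" if x: "0 < x" for x
  proof -
    have "J * x powr q \<le> K * T powr q * x powr q" by (rule mult_right_mono[OF J]) simp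
    then have "J / q * x powr q \<le> K / q * (T * x) powr q"
      using q24 by (simp add: divide_right_mono powr_mult)
    moreover have "d / 4 * ((T * x)\<^sup>2 + (T * x) ^ 4)
        \<le> a / 2 * (T * x)\<^sup>2 + b / 4 * (T * x) ^ 4 - K / q * (T * x) powr q"
      using kirchhoff_coercive_primitive[OF q24(1), of "T * x" d a b K] T x d by simp
    moreover have "f x = a / 2 * (T * x)\<^sup>2 + b / 4 * (T * x) ^ 4 - J / q * x powr q"
      using x by (simp add: f_def)
    ultimately show ?thesis by linarith
  qed
  have Hle: "H x \<le> \<epsilon> * x\<^sup>2 * A + C' * x powr q * J"
    if "0 < x" "0 \<le> \<epsilon>" "0 \<le> C'" "\<And>y t. \<bar>h y t\<bar> \<le> \<epsilon> * \<bar>t\<bar> + C' * \<bar>t\<bar> powr (q - 1)" for x \<epsilon> C'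
    unfolding H_def A_def J_def by (rule integral_primitive_le[OF um i2 iq that])
  have "d / 4 / m \<le> (THE l. l \<ge> 0 \<and> (\<exists>\<zeta> > 0. f \<zeta> - l * H \<zeta> = 0 \<and>
     ((\<lambda>\<zeta>. f \<zeta> - l * H \<zeta>) has_real_derivative 0) (at \<zeta>) \<and>
     ereal (f \<zeta> - l * H \<zeta>) = (INF \<rho> \<in> {0<..}. ereal (f \<rho> - l * H \<rho>))))"
  proof (rule extremal_parameter_ge)
    fix x :: real assume x: "0 < x"
    \<comment> \<open>The derivative is computed without the absolute value and transferred to
      \<open>f\<close>, which agrees with this function on the open half-line.\<close>
    have "((\<lambda>\<zeta>. a / 2 * (T * \<zeta>)\<^sup>2 + b / 4 * (T * \<zeta>) ^ 4 - J / q * \<zeta> powr q) has_real_derivative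
      (a * T\<^sup>2 * x + b * T ^ 4 * x ^ 3 - J * x powr (q - 1))) (at x)"
      using x q24 by (auto intro!: derivative_eq_intros simp: power2_eq_square power3_eq_cube power4_eq_xxxx)
    then have "(f has_real_derivative (a * T\<^sup>2 * x + b * T ^ 4 * x ^ 3 - J * x powr (q - 1))) (at x)"
      by (rule has_field_derivative_transform_within_open[of _ _ _ "{0<..}"]) (use x in \<open>auto simp: f_def\<close>)
    then show "f differentiable (at x)" by (auto simp: real_differentiable_def)
    show "H differentiable (at x)"
      using integral_primitive_differentiable[OF um i2 iq x] by (auto simp: H_def real_differentiable_def)
    show "0 < H x" unfolding H_def by (rule integral_primitive_pos[OF um i2 iq x nz])
    have "H x \<le> 1 * x\<^sup>2 * A + C * x powr q * J" by (rule Hle[OF x _ C]) simp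
    also have "\<dots> \<le> 1 * x\<^sup>2 * ((measure lebesgue \<Omega> + K) * T\<^sup>2) + C * x powr q * (K * T powr q)"
      using AT J C by (intro add_mono mult_left_mono) auto
    also have "\<dots> = (measure lebesgue \<Omega> + K) * (T * x)\<^sup>2 + C * K * (T * x) powr q"
      using T x by (simp add: powr_mult power_mult_distrib)
    also have "\<dots> \<le> (measure lebesgue \<Omega> + K) * ((T * x)\<^sup>2 + (T * x) ^ 4) + C * K * ((T * x)\<^sup>2 + (T * x) ^ 4)"
      using T x q24 C K0 by (intro add_mono mult_left_mono powr_le_power2_plus_power4) auto
    also have "\<dots> \<le> m * ((T * x)\<^sup>2 + (T * x) ^ 4)" by (simp add: m_def algebra_simps)
    finally have "d / 4 / m * H x \<le> d / 4 / m * (m * ((T * x)\<^sup>2 + (T * x) ^ 4))"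
      using d m by (intro mult_left_mono) auto
    also have "\<dots> = d / 4 * ((T * x)\<^sup>2 + (T * x) ^ 4)" using m by simp
    also have "\<dots> \<le> f x" by (rule fge[OF x])
    finally show "d / 4 / m * H x \<le> f x" .
  next
    show "0 \<le> d / 4 / m" using d m by simp
  next
    fix R :: real assume R: "0 < R"
    \<comment> \<open>Chosen so that R \<epsilon> A \<le> (d/8) T^2, half of the quadratic
      coefficient of the lower bound for \<open>f\<close>. The remaining term of R H, divided by
      x^2, is a multiple of x^(q-2), which tends to 0 and fits into the other half. The added 1
      keeps the denominator positive, as \<open>A\<close> is only known to be nonnegative.\<close>
    define \<epsilon> where "\<epsilon> = d / 4 * T\<^sup>2 / (2 * R * (A + 1))"
    have \<epsilon>: "\<epsilon> > 0" unfolding \<epsilon>_def using d T R A0 by (intro divide_pos_pos mult_pos_pos) auto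
    obtain C' where C': "C' \<ge> 0" "\<And>y t. \<bar>h y t\<bar> \<le> \<epsilon> * \<bar>t\<bar> + C' * \<bar>t\<bar> powr (q - 1)"
      using growth[OF \<epsilon>] by auto
    have "((\<lambda>x. R * C' * J * x powr (q - 2)) \<longlongrightarrow> R * C' * J * 0) (at_right 0)"
      using q24 by (intro tendsto_mult tendsto_const tendsto_powr'[where b="q - 2", THEN tendsto_eq_rhs])
        (auto intro!: tendsto_eq_intros eventually_at_rightI[of 0 1])
    moreover have "R * C' * J * 0 < d / 8 * T\<^sup>2" using d T by simp
    ultimately have "eventually (\<lambda>x. R * C' * J * x powr (q - 2) < d / 8 * T\<^sup>2) (at_right 0)"
      by (rule order_tendstoD(2))
    moreover have "eventually (\<lambda>x::real. 0 < x) (at_right 0)" by (simp add: eventually_at_right_less)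
    ultimately show "eventually (\<lambda>x. R * H x < f x) (at_right 0)"
    proof eventually_elim
      case (elim x)
      have "R * H x \<le> R * (\<epsilon> * x\<^sup>2 * A + C' * x powr q * J)"
        using Hle[OF elim(2) _ C'] \<epsilon> R by (intro mult_left_mono) auto
      also have "\<dots> = (R * \<epsilon> * A + R * C' * J * x powr (q - 2)) * x\<^sup>2"
      proof -
        have "x powr q = x powr (q - 2) * x\<^sup>2" using elim by (simp add: powr_diff powr_numeral)
        then show ?thesis by (simp add: algebra_simps)
      qed
      also have "\<dots> < (d / 8 * T\<^sup>2 + d / 8 * T\<^sup>2) * x\<^sup>2"
      proof -
        have "R * \<epsilon> * A = d / 8 * T\<^sup>2 * (A / (A + 1))" using R by (simp add: \<epsilon>_def)
        also have "\<dots> \<le> d / 8 * T\<^sup>2 * 1" using d A0 by (intro mult_left_mono) auto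
        finally have "R * \<epsilon> * A \<le> d / 8 * T\<^sup>2" by simp
        then show ?thesis using elim by (intro mult_strict_right_mono add_le_less_mono) auto
      qed
      also have "\<dots> \<le> d / 4 * ((T * x)\<^sup>2 + (T * x) ^ 4)"
        using d by (simp add: power_mult_distrib algebra_simps)
      also have "\<dots> \<le> f x" using fge elim by simp
      finally show ?case .
    qed
    \<comment> \<open>At infinity the quartic term wins: after division by x^4 the bound for R H has
      only the negative powers x^(-2) and x^(q-4), the latter because q < 4.\<close>
    have "((\<lambda>x. R * A * x powr (-2) + R * C * J * x powr (q - 4)) \<longlongrightarrow> R * A * 0 + R * C * J * 0) at_top"
      using q24 by (intro tendsto_add tendsto_mult tendsto_const tendsto_neg_powr filterlim_ident) auto
    moreover have "R * A * 0 + R * C * J * 0 < d / 4 * T ^ 4" using d T by simp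
    ultimately have "eventually (\<lambda>x. R * A * x powr (-2) + R * C * J * x powr (q - 4) < d / 4 * T ^ 4) at_top"
      by (rule order_tendstoD(2))
    moreover have "eventually (\<lambda>x::real. 0 < x) at_top" by (rule eventually_gt_at_top)
    ultimately show "eventually (\<lambda>x. R * H x < f x) at_top"
    proof eventually_elim
      case (elim x)
      have "R * H x \<le> R * (1 * x\<^sup>2 * A + C * x powr q * J)"
        using Hle[OF elim(2) _ C] R by (intro mult_left_mono) auto
      also have "\<dots> = (R * A * x powr (-2) + R * C * J * x powr (q - 4)) * x ^ 4"
      proof -
        have "x powr q = x powr (q - 4) * x ^ 4" using elim by (simp add: powr_diff powr_numeral)
        moreover have "x\<^sup>2 = x powr (-2) * x ^ 4"
          using elim by (simp add: powr_minus powr_numeral field_simps power2_eq_square power4_eq_xxxx)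
        ultimately show ?thesis by (simp add: algebra_simps)
      qed
      also have "\<dots> < d / 4 * T ^ 4 * x ^ 4"
        using elim by (intro mult_strict_right_mono) auto
      also have "\<dots> \<le> d / 4 * ((T * x)\<^sup>2 + (T * x) ^ 4)"
        using d by (simp add: power_mult_distrib algebra_simps)
      also have "\<dots> \<le> f x" using fge elim by simp
      finally show ?case .
    qed
  qed
  moreover have "fiber s \<Omega> g a b l u = (\<lambda>\<zeta>. f \<zeta> - l * H \<zeta>)" for l
    using fiber_eq[OF \<Omega>m gh q24(1)[unfolded q_def], of a b l u]
    by (auto simp: f_def H_def T_def J_def q_def)
  ultimately show ?thesis by (simp add: lambda0_def m_def)
qed

text \<open>Testing with \<open>u\<close> itself gives d(T^2 + T^4) \<le> l m (T^2 + T^4), where T >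
  0 is the norm of a nontrivial solution and \<open>m\<close> the constant in the smallness
  condition. This contradicts l m < d.\<close>

lemma weak_solution_trivial:
  fixes g h :: "real ^ 'n \<Rightarrow> real \<Rightarrow> real" and \<Omega> :: "(real ^ 'n) set"
  assumes s: "0 < s" "s < 1" and N: "real CARD('n) > 4 * s"
    and \<Omega>: "open \<Omega>" "bounded \<Omega>" "\<Omega> \<noteq> {}"
  defines "q \<equiv> crit_exp (real CARD('n)) s" and "K \<equiv> S_const s \<Omega> powr (- (crit_exp (real CARD('n)) s / 2))"
  assumes gh: "AE x in lebesgue_on \<Omega>. g x = h x"
    and C: "0 \<le> C" "\<And>x t. \<bar>h x t\<bar> \<le> 1 * \<bar>t\<bar> + C * \<bar>t\<bar> powr (q - 1)"
    and d: "\<And>t. 0 \<le> t \<Longrightarrow> d * (t\<^sup>2 + t ^ 4) \<le> a * t\<^sup>2 + b * t ^ 4 - K * t powr q"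
    and l: "0 < l" "l * (measure lebesgue \<Omega> + K + C * K + 1) < d"
    and u: "weak_solution s \<Omega> g a b l u"
  shows "AE x in lebesgue. u x = 0"
proof (rule ccontr)
  assume nz: "\<not> (AE x in lebesgue. u x = 0)"
  have \<Omega>m: "\<Omega> \<in> sets lebesgue" using \<Omega> by auto
  have q24: "2 < q" "q < 4" unfolding q_def using crit_exp_bounds[OF s(1) N] by auto
  have uX: "u \<in> X0_space s \<Omega>" using u by (simp add: weak_solution_def)
  then have un: "u \<in> X0_nonzero s \<Omega>" using nz by (simp add: X0_nonzero_def)
  have i2: "integrable (lebesgue_on \<Omega>) (\<lambda>x. (u x)\<^sup>2)" using uX by (simp add: X0_space_def)
  have iq: "integrable (lebesgue_on \<Omega>) (\<lambda>x. \<bar>u x\<bar> powr q)"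
    unfolding q_def by (rule sobolev_integrable[OF s(1) N \<Omega>m \<Omega>(2) uX])
  define T where "T = X0_norm s \<Omega> u"
  define A where "A = (LINT x|lebesgue_on \<Omega>. (u x)\<^sup>2)"
  define J where "J = (LINT x|lebesgue_on \<Omega>. \<bar>u x\<bar> powr q)"
  define m where "m = measure lebesgue \<Omega> + K + C * K + 1"
  have T: "T > 0" unfolding T_def by (rule X0_nonzero_pos(3)[OF s(1) N \<Omega>m \<Omega>(2) un])
  have K0: "K \<ge> 0" by (simp add: K_def)
  have J: "J \<le> K * T powr q"
    using critical_integral_le[OF s N \<Omega> un] by (simp add: J_def K_def T_def q_def)
  have AT: "A \<le> (measure lebesgue \<Omega> + K) * T\<^sup>2"
    using poincare_inequality[OF s N \<Omega> un] by (simp add: A_def K_def T_def)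
  have split: "\<bar>t\<bar> powr (q - 1) * \<bar>t\<bar> = \<bar>t\<bar> powr q" for t :: real
  proof -
    have "\<bar>t\<bar> powr (q - 1) * \<bar>t\<bar> powr 1 = \<bar>t\<bar> powr q" by (simp only: powr_add[symmetric]) simp
    then show ?thesis by simp
  qed
  have "\<bar>t\<bar> powr (q - 2) * t * t = \<bar>t\<bar> powr q" for t :: real
    by (cases "t = 0") (simp_all add: powr_diff powr_numeral field_simps power2_eq_square)
  then have "(a + b * T\<^sup>2) * T\<^sup>2 = J + l * (LINT x|lebesgue_on \<Omega>. g x (u x) * u x)"
    using u uX by (simp add: weak_solution_def T_def J_def X0_norm_sq q_def)
  moreover have "(LINT x|lebesgue_on \<Omega>. g x (u x) * u x) \<le> A + C * J"
  proof -
    have "(LINT x|lebesgue_on \<Omega>. g x (u x) * u x) \<le> (LINT x|lebesgue_on \<Omega>. (u x)\<^sup>2 + C * \<bar>u x\<bar> powr q)"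
    \<comment> \<open>If the left integrand were not integrable, its integral would be 0 by default;
      nonnegativity of the integrable majorant covers that case.\<close>
    proof (rule integral_mono_AE')
      show "integrable (lebesgue_on \<Omega>) (\<lambda>x. (u x)\<^sup>2 + C * \<bar>u x\<bar> powr q)" using i2 iq by auto
      show "AE x in lebesgue_on \<Omega>. g x (u x) * u x \<le> (u x)\<^sup>2 + C * \<bar>u x\<bar> powr q"
        using gh
      proof eventually_elim
        case (elim x)
        have "g x (u x) * u x \<le> \<bar>h x (u x)\<bar> * \<bar>u x\<bar>" by (simp add: elim flip: abs_mult)
        also have "\<dots> \<le> (1 * \<bar>u x\<bar> + C * \<bar>u x\<bar> powr (q - 1)) * \<bar>u x\<bar>"
          by (intro mult_right_mono C) simp
        also have "\<dots> = (u x)\<^sup>2 + C * (\<bar>u x\<bar> powr (q - 1) * \<bar>u x\<bar>)"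
          by (simp add: algebra_simps power2_eq_square)
        finally show ?case by (simp only: split)
      qed
      show "AE x in lebesgue_on \<Omega>. 0 \<le> (u x)\<^sup>2 + C * \<bar>u x\<bar> powr q" using C by simp
    qed
    also have "\<dots> = A + C * J" using i2 iq by (simp add: A_def J_def)
    finally show ?thesis .
  qed
  ultimately have "(a + b * T\<^sup>2) * T\<^sup>2 - J \<le> l * (A + C * J)" using l by simp
  moreover have "d * (T\<^sup>2 + T ^ 4) \<le> (a + b * T\<^sup>2) * T\<^sup>2 - J"
    using d[of T] J T by (simp add: algebra_simps power2_eq_square power4_eq_xxxx)
  moreover have "A + C * J \<le> m * (T\<^sup>2 + T ^ 4)"
  proof -
    have "A + C * J \<le> (measure lebesgue \<Omega> + K) * T\<^sup>2 + C * (K * T powr q)"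
      using AT J C by (intro add_mono mult_left_mono) auto
    also have "\<dots> \<le> (measure lebesgue \<Omega> + K) * (T\<^sup>2 + T ^ 4) + C * (K * (T\<^sup>2 + T ^ 4))"
      using T q24 C K0 by (intro add_mono mult_left_mono powr_le_power2_plus_power4) auto
    also have "\<dots> \<le> m * (T\<^sup>2 + T ^ 4)" by (simp add: m_def algebra_simps)
    finally show ?thesis .
  qed
  ultimately have "d * (T\<^sup>2 + T ^ 4) \<le> l * (m * (T\<^sup>2 + T ^ 4))"
    using mult_left_mono[of "A + C * J" "m * (T\<^sup>2 + T ^ 4)" l] l by linarith
  moreover have "l * m * (T\<^sup>2 + T ^ 4) < d * (T\<^sup>2 + T ^ 4)"
    using l T by (intro mult_strict_right_mono) (auto simp: m_def add_pos_pos)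
  ultimately show False by simp
qed

text \<open>The function vanishes only off a null set \<open>N\<close>, so the inner product needs
  the pairs with a coordinate in \<open>N\<close> to be null for the product measure; off them both
  values of u in the integrand are 0.\<close>

lemma weak_solution_zero:
  fixes g :: "real ^ 'n \<Rightarrow> real \<Rightarrow> real"
  assumes \<Omega>: "\<Omega> \<in> sets lebesgue" and g0: "AE x in lebesgue_on \<Omega>. g x 0 = 0"
    and uX: "u \<in> X0_space s \<Omega>" and u0: "AE x in lebesgue. u x = 0"
  shows "weak_solution s \<Omega> g a b l u"
proof -
  have "AE x in lebesgue_on \<Omega>. u x = 0"
    using u0 \<Omega> by (subst AE_restrict_space_iff) auto
  then have 1: "(LINT x|lebesgue_on \<Omega>. \<bar>u x\<bar> powr r * u x * v x) = 0"
    and 2: "(LINT x|lebesgue_on \<Omega>. g x (u x) * v x) = 0" for r v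
    using g0 by (auto intro!: integral_eq_zero_AE elim: eventually_elim2)
  obtain N where N: "\<And>x. x \<notin> N \<Longrightarrow> u x = 0" "N \<in> null_sets lebesgue"
    using AE_E3[OF u0] by auto
  have uN: "u x \<noteq> 0 \<Longrightarrow> x \<in> N" for x using N(1) by blast
  have null: "N \<times> UNIV \<union> UNIV \<times> N \<in> null_sets (lebesgue \<Otimes>\<^sub>M lebesgue)"
    by (intro null_sets.Un lebesgue.times_in_null_sets1 lebesgue.times_in_null_sets2 N(2)) auto
  have "X0_inner s \<Omega> u v = 0" for v
    unfolding X0_inner_def set_lebesgue_integral_def
    by (rule integral_eq_zero_AE, rule AE_I'[OF null]) (use uN in \<open>auto, metis\<close>)
  then show ?thesis using uX 1 2 by (simp add: weak_solution_def)
qed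

theorem mainTheorem8:
  fixes s a b :: real
    and \<Omega> :: "(real ^ 'n) set"
    and g :: "real ^ 'n \<Rightarrow> real \<Rightarrow> real"
  assumes s: "0 < s" "s < 1"
    and N: "real CARD('n) > 4 * s"
    and dom: "bounded_lipschitz_domain \<Omega>"
    and H1: "caratheodory_on \<Omega> g" "AE x in lebesgue_on \<Omega>. g x 0 = 0"
    and H2: "AE x in lebesgue_on \<Omega>. (\<forall>t>0. g x t > 0) \<and> (\<forall>t<0. g x t < 0)"
      "\<exists>\<mu>>0. \<exists>I. open I \<and> is_interval I \<and> I \<noteq> {} \<and> I \<subseteq> {0<..} \<and>
         (AE x in lebesgue_on \<Omega>. \<forall>t\<in>I. g x t \<ge> \<mu>)"
    and H3: "\<exists>c>0. \<exists>p. 2 < p \<and> p < crit_exp (real CARD('n)) s \<and>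
         (AE x in lebesgue_on \<Omega>. \<forall>t. \<bar>g x t\<bar> \<le> c * (1 + \<bar>t\<bar> powr (p - 1)))"
    and H4: "uniform_limit \<Omega> (\<lambda>t x. g x t / \<bar>t\<bar>) (\<lambda>x. 0) (at 0)"
    and H5: "\<forall>u \<in> X0_space s \<Omega>.
         (\<lambda>\<zeta>. LINT x|lebesgue_on \<Omega>. g x (\<zeta> * u x)) C1_differentiable_on {0<..}"
    and ab: "a > 0" "b > 0"
      "a powr ((real CARD('n) - 4 * s) / (2 * s)) * b > PS_const s \<Omega>"
  shows "\<exists>lbar. 0 < lbar \<and> lbar < lambda0_bar s \<Omega> g a b \<and>
     (\<forall>l. 0 < l \<and> l < lbar \<longrightarrow>
        (\<forall>u. weak_solution s \<Omega> g a b l u \<longleftrightarrow>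
             u \<in> X0_space s \<Omega> \<and> (AE x in lebesgue. u x = 0)))"
proof -
  define q where "q = crit_exp (real CARD('n)) s"
  define K where "K = S_const s \<Omega> powr (- (crit_exp (real CARD('n)) s / 2))"
  have \<Omega>: "open \<Omega>" "bounded \<Omega>" "\<Omega> \<noteq> {}" using dom by (auto simp: bounded_lipschitz_domain_def)
  have \<Omega>m: "\<Omega> \<in> sets lebesgue" using \<Omega> by auto
  have S: "0 < S_const s \<Omega>" by (rule S_const_pos[OF s N \<Omega>])
  have q: "2 < q" using crit_exp_bounds[OF s(1) N] by (simp add: q_def)
  obtain d where d: "0 < d" "\<And>t. 0 \<le> t \<Longrightarrow> d * (t\<^sup>2 + t ^ 4) \<le> a * t\<^sup>2 + b * t ^ 4 - K * t powr q"
    using kirchhoff_coercive[OF s(1) N ab(1,2) S ab(3)[unfolded PS_const_def Let_def]]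
    unfolding q_def K_def by blast
  obtain h where gh: "AE x in lebesgue_on \<Omega>. g x = h x"
    and h: "superlinear_nonlinearity (lebesgue_on \<Omega>) h q"
    using nonlinearity_representative[OF q \<Omega>m H1 H2(1) H3[folded q_def] H4] .
  obtain C where C: "0 \<le> C" "\<And>x t. \<bar>h x t\<bar> \<le> 1 * \<bar>t\<bar> + C * \<bar>t\<bar> powr (q - 1)"
    using superlinear_nonlinearity.growth[OF h, of 1] by auto
  define m where "m = measure lebesgue \<Omega> + K + C * K + 1"
  have m: "m > 0" using C by (simp add: m_def K_def add_nonneg_pos)
  \<comment> \<open>\<open>\<kappa>\<close> bounds every \<open>lambda0\<close> from below. Its half
    is the witness: it lies strictly below the infimum, and l < \<kappa>/2 gives l m < d/8, well
    within the range of \<open>weak_solution_trivial\<close>.\<close>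
  define \<kappa> where "\<kappa> = d / 4 / m"
  have \<kappa>: "\<kappa> > 0" using d m by (simp add: \<kappa>_def)
  have "\<kappa> \<le> lambda0_bar s \<Omega> g a b"
    unfolding lambda0_bar_def
  proof (rule cINF_greatest)
    show "X0_nonzero s \<Omega> \<noteq> {}" by (rule X0_nonzero_nonempty[OF s \<Omega>])
    fix u assume "u \<in> X0_nonzero s \<Omega>"
    then show "\<kappa> \<le> lambda0 s \<Omega> g a b u"
      unfolding \<kappa>_def m_def K_def
      using C d by (intro lambda0_ge[OF s N \<Omega> _ gh h[unfolded q_def]]) (simp_all add: q_def K_def)
  qed
  moreover have "weak_solution s \<Omega> g a b l u \<longleftrightarrow> u \<in> X0_space s \<Omega> \<and> (AE x in lebesgue. u x = 0)"
    if l: "0 < l" "l < \<kappa> / 2" for l u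
  proof
    assume u: "weak_solution s \<Omega> g a b l u"
    have "l * m < \<kappa> / 2 * m" using l m by (intro mult_strict_right_mono)
    also have "\<dots> < d" using d m by (simp add: \<kappa>_def)
    finally have "l * m < d" .
    then have "AE x in lebesgue. u x = 0"
      using C d l unfolding m_def K_def
      by (intro weak_solution_trivial[OF s N \<Omega> gh _ _ _ _ _ u]) (simp_all add: q_def K_def)
    then show "u \<in> X0_space s \<Omega> \<and> (AE x in lebesgue. u x = 0)"
      using u by (simp add: weak_solution_def)
  next
    assume "u \<in> X0_space s \<Omega> \<and> (AE x in lebesgue. u x = 0)"
    then show "weak_solution s \<Omega> g a b l u"
      using H1(2) by (intro weak_solution_zero \<Omega>m) auto
  qed
  ultimately show ?thesis using \<kappa> by (intro exI[of _ "\<kappa> / 2"]) auto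
qed

end
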